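(* Assume: $(A,B)$ is stabilizable; $\mathcal{Y}\subseteq\mathbb{R}^{n_y}$ is a compact polyhedron with $0\in\mathrm{Int}\,\mathcal{Y}$; $G_z$ has full rank; $Q=Q^T\succeq0$ with $(A,Q)$ observable and $R=R^T\succ0$; $P=P^T\succeq 0$ and, for all $(x,v)\in\mathcal{T}$, with $\delta x=x-\bar x_v$, $\|(A-BK)\delta x\|_P^2-\|\delta x\|_P^2\le-\|\delta x\|^2_{Q+K^TRK}$; for all $(x,v)\in\mathcal{T}$, $(Ax+B\kappa_N(x,v),v)\in\mathcal{T}$ and $Cx+D\kappa_N(x,v)\in\mathcal{Y}$; $\Sigma\subset\mathrm{Int}\,\Gamma_N$; and $\mathcal{F}\subseteq\Gamma_N$ is closed, convex, polyhedral and satisfies $\Sigma\subset\mathrm{Int}\,\mathcal{F}$. Let $r\in\mathbb{R}^{n_z}$ be a constant reference. Consider the closed-loop system with $v_0=\bar g(x_0)$ and $$x_{k+1}=f(x_k,v_k),\qquad v_{k+1}=g(x_{k+1},v_k),\qquad k\in\mathbb{N}.$$ Then, for all $x_0\in\Pi_x\Phi$, there exists $t\ge0$ such that $v_k=v^*$ for all $k\ge t$.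
   Context: System: $x_{k+1}=Ax_k+Bu_k$, $y_k=Cx_k+Du_k$, $z_k=Ex_k+Fu_k$, with $x_k\in\mathbb{R}^{n_x}$, $u_k\in\mathbb{R}^{n_u}$, constrained output $y_k\in\mathbb{R}^{n_y}$, tracking output $z_k\in\mathbb{R}^{n_z}$. $\mathbb{N}$ includes $0$. Constraint: $y_k\in\mathcal{Y}$. Equilibria: let $Z=\begin{bmatrix} A-I & B & 0 \\ E & F & -I \end{bmatrix}$ and let $G=[G_x^T\ G_u^T\ G_z^T]^T$ be a matrix with $n_v$ columns forming a basis of $\ker Z$ (block rows of sizes $n_x,n_u,n_z$). For $v\in\mathbb{R}^{n_v}$ put $\bar x_v=G_xv$, $\bar u_v=G_uv$, $\bar z_v=G_zv$. Let $G_y=CG_x+DG_u$, fix $\epsilon\in(0,1)$, let $\mathcal{V}_\epsilon=\{v\in\mathbb{R}^{n_v}\mid G_yv\in(1-\epsilon)\mathcal{Y}\}$ and $\Sigma=\{(x,v)\mid x=G_xv,\ v\in\mathcal{V}_\epsilon\}$. MPC: $N\ge1$ is the horizon, $\mathcal{T}\subseteq\mathbb{R}^{n_x}\times\mathbb{R}^{n_v}$ is a polyhedral terminal set, $K\in\mathbb{R}^{n_u\times n_x}$ is a gain, $\kappa_N(x,v)=\bar u_v-K(x-\bar x_v)$, and $\|x\|_P=\sqrt{x^TPx}$. The optimal control problem with parameter $(x,v)$ is to minimize over $\mu=(\mu_0,\dots,\mu_{N-1})$ the cost $\|\xi_N-\bar x_v\|_P^2+\sum_{i=0}^{N-1}\left(\|\xi_i-\bar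 x_v\|_Q^2+\|\mu_i-\bar u_v\|_R^2\right)$ subject to $\xi_0=x$, $\xi_{i+1}=A\xi_i+B\mu_i$, $C\xi_i+D\mu_i\in\mathcal{Y}$ for $i=0,\dots,N-1$, and $(\xi_N,v)\in\mathcal{T}$. $\Gamma_N$ is the set of $(x,v)$ for which these constraints are feasible. For $(x,v)\in\Gamma_N$, $\kappa(x,v)=\mu_0^\star(x,v)$ is the first element of the minimizer, and $f(x,v)=Ax+B\kappa(x,v)$. Feasibility Governor: $v^*=v_r^*$ is a fixed chosen element of $\mathrm{argmin}_{v\in\mathcal{V}_\epsilon}\|G_zv-r\|_2^2$. Let $\psi(v,r)=\|G_zv-r\|_2^2$ if $G_z$ is injective, and $\psi(v,r)=\|v-v_r^*\|_2^2$ otherwise. Let $\Phi=\mathcal{F}\cap(\mathbb{R}^{n_x}\times\mathcal{V}_\epsilon)$, $\Lambda=\Gamma_N\cap(\mathbb{R}^{n_x}\times\mathcal{V}_\epsilon)$, $\Pi_x\Phi=\{x\mid\exists v:(x,v)\in\Phi\}$. For $x\in\Pi_x\Phi$, $\bar g(x)=\mathrm{argmin}\{\psi(v,r)\mid (x,v)\in\Phi\}$; and $g(x,v)=\bar g(x)$ if $(x,v)\in\Phi$, $g(x,v)=v$ if $(x,v)\in\Lambda\setminus\Phi$. *)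

theory Defs
  imports "HOL-Analysis.Analysis"
begin

definition schur_stable :: "real^'n^'n \<Rightarrow> bool" where
  "schur_stable M \<longleftrightarrow>
     (\<forall>(c::complex) (w::complex^'n).
        w \<noteq> 0 \<and> map_matrix complex_of_real M *v w = c *s w \<longrightarrow> cmod c < 1)"

definition stabilizable :: "real^'n^'n \<Rightarrow> real^'m^'n \<Rightarrow> bool" where
  "stabilizable A B \<longleftrightarrow> (\<exists>L::real^'n^'m. schur_stable (A - B ** L))"

text \<open>The initial state of \<open>x\<^sub>k\<^sub>+\<^sub>1 = A x\<^sub>k\<close> is determined by the output \<open>H x\<^sub>k\<close>.
  Powers of \<open>A\<close> are written as iterates of the map \<open>(*v) A\<close>, because \<open>^\<close> is
  the componentwise power on the type of matrices.\<close>

definition observable :: "real^'n^'n \<Rightarrow> real^'n^'p \<Rightarrow> bool" where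
  "observable A H \<longleftrightarrow>
     (\<forall>x x'. (\<forall>k::nat. H *v (((*v) A ^^ k) x) = H *v (((*v) A ^^ k) x')) \<longrightarrow> x = x')"

definition symmetric_mat :: "real^'n^'n \<Rightarrow> bool" where
  "symmetric_mat M \<longleftrightarrow> transpose M = M"

definition pos_semidef :: "real^'n^'n \<Rightarrow> bool" where
  "pos_semidef M \<longleftrightarrow> (\<forall>x. 0 \<le> x \<bullet> (M *v x))"

definition pos_def :: "real^'n^'n \<Rightarrow> bool" where
  "pos_def M \<longleftrightarrow> (\<forall>x. x \<noteq> 0 \<longrightarrow> 0 < x \<bullet> (M *v x))"

definition wnorm :: "real^'n^'n \<Rightarrow> real^'n \<Rightarrow> real" where
  "wnorm M x = sqrt (x \<bullet> (M *v x))"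

definition full_rank :: "real^'n^'m \<Rightarrow> bool" where
  "full_rank M \<longleftrightarrow> rank M = min CARD('m) CARD('n)"

text \<open>The block matrix with rows \<open>[A - I, B, 0]\<close> and \<open>[E, F, -I]\<close>; its block rows and
  columns are indexed by sum types.\<close>

definition equilibrium_matrix ::
  "real^'nx^'nx \<Rightarrow> real^'nu^'nx \<Rightarrow> real^'nx^'nz \<Rightarrow> real^'nu^'nz
     \<Rightarrow> real^('nx::finite + 'nu::finite + 'nz::finite)^('nx + 'nz)" where
  "equilibrium_matrix A B E F = (\<chi> i j.
     (case i of
        Inl a \<Rightarrow> (case j of
            Inl b \<Rightarrow> (A - mat 1) $ a $ b
          | Inr j' \<Rightarrow> (case j' of Inl b \<Rightarrow> B $ a $ b | Inr b \<Rightarrow> 0))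
      | Inr a \<Rightarrow> (case j of
            Inl b \<Rightarrow> E $ a $ b
          | Inr j' \<Rightarrow> (case j' of Inl b \<Rightarrow> F $ a $ b | Inr b \<Rightarrow> (- mat 1) $ a $ b))))"

text \<open>Since \<open>columns G\<close> is a set, injectivity excludes repeated columns.\<close>

definition kernel_basis :: "real^'n^'m \<Rightarrow> real^'v^'n \<Rightarrow> bool" where
  "kernel_basis Z G \<longleftrightarrow>
     inj (\<lambda>j. column j G) \<and> independent (columns G) \<and> span (columns G) = {w. Z *v w = 0}"

definition Gx :: "real^'nv^('nx::finite + 'nu::finite + 'nz::finite) \<Rightarrow> real^'nv^'nx" where
  "Gx G = (\<chi> i j. G $ Inl i $ j)"

definition Gu :: "real^'nv^('nx::finite + 'nu::finite + 'nz::finite) \<Rightarrow> real^'nv^'nu" where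
  "Gu G = (\<chi> i j. G $ Inr (Inl i) $ j)"

definition Gz :: "real^'nv^('nx::finite + 'nu::finite + 'nz::finite) \<Rightarrow> real^'nv^'nz" where
  "Gz G = (\<chi> i j. G $ Inr (Inr i) $ j)"

definition Gy :: "real^'nx^'ny \<Rightarrow> real^'nu^'ny \<Rightarrow> real^'nv^('nx::finite + 'nu::finite + 'nz::finite) \<Rightarrow> real^'nv^'ny" where
  "Gy C D G = C ** Gx G + D ** Gu G"

definition xbar :: "real^'nv^('nx::finite + 'nu::finite + 'nz::finite) \<Rightarrow> real^'nv \<Rightarrow> real^'nx" where
  "xbar G v = Gx G *v v"

definition ubar :: "real^'nv^('nx::finite + 'nu::finite + 'nz::finite) \<Rightarrow> real^'nv \<Rightarrow> real^'nu" where
  "ubar G v = Gu G *v v"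

definition V_eps ::
  "real^'nx^'ny \<Rightarrow> real^'nu^'ny \<Rightarrow> real^'nv^('nx::finite + 'nu::finite + 'nz::finite) \<Rightarrow> (real^'ny) set \<Rightarrow> real
     \<Rightarrow> (real^'nv) set" where
  "V_eps C D G Y \<epsilon> = {v. Gy C D G *v v \<in> (\<lambda>y. (1 - \<epsilon>) *\<^sub>R y) ` Y}"

definition steady_set ::
  "real^'nx^'ny \<Rightarrow> real^'nu^'ny \<Rightarrow> real^'nv^('nx::finite + 'nu::finite + 'nz::finite) \<Rightarrow> (real^'ny) set \<Rightarrow> real
     \<Rightarrow> ((real^'nx) \<times> (real^'nv)) set" where
  "steady_set C D G Y \<epsilon> = {(x, v). x = Gx G *v v \<and> v \<in> V_eps C D G Y \<epsilon>}"

definition terminal_law ::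
  "real^'nv^('nx::finite + 'nu::finite + 'nz::finite) \<Rightarrow> real^'nx^'nu \<Rightarrow> real^'nx \<Rightarrow> real^'nv \<Rightarrow> real^'nu" where
  "terminal_law G K x v = ubar G v - K *v (x - xbar G v)"

primrec traj ::
  "real^'nx^'nx \<Rightarrow> real^'nu^'nx \<Rightarrow> real^'nx \<Rightarrow> (nat \<Rightarrow> real^'nu) \<Rightarrow> nat \<Rightarrow> real^'nx" where
  "traj A B x \<mu> 0 = x"
| "traj A B x \<mu> (Suc i) = A *v traj A B x \<mu> i + B *v \<mu> i"

text \<open>Input sequences \<open>\<mu>\<^sub>0, \<dots>, \<mu>\<^sub>N\<^sub>-\<^sub>1\<close> are extensional functions on \<open>{..<N}\<close>, so that
  uniqueness of a minimizing sequence is meaningful.\<close>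

definition ocp_feasible ::
  "real^'nx^'nx \<Rightarrow> real^'nu^'nx \<Rightarrow> real^'nx^'ny \<Rightarrow> real^'nu^'ny \<Rightarrow> (real^'ny) set
     \<Rightarrow> nat \<Rightarrow> ((real^'nx) \<times> (real^'nv)) set \<Rightarrow> real^'nx \<Rightarrow> real^'nv \<Rightarrow> (nat \<Rightarrow> real^'nu) set" where
  "ocp_feasible A B C D Y N T x v =
     {\<mu> \<in> {..<N} \<rightarrow>\<^sub>E UNIV.
        (\<forall>i<N. C *v traj A B x \<mu> i + D *v \<mu> i \<in> Y) \<and> (traj A B x \<mu> N, v) \<in> T}"

definition ocp_cost ::
  "real^'nx^'nx \<Rightarrow> real^'nu^'nx \<Rightarrow> real^'nv^('nx::finite + 'nu::finite + 'nz::finite) \<Rightarrow> nat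
     \<Rightarrow> real^'nx^'nx \<Rightarrow> real^'nx^'nx \<Rightarrow> real^'nu^'nu
     \<Rightarrow> real^'nx \<Rightarrow> real^'nv \<Rightarrow> (nat \<Rightarrow> real^'nu) \<Rightarrow> real" where
  "ocp_cost A B G N P Q R x v \<mu> =
     (wnorm P (traj A B x \<mu> N - xbar G v))\<^sup>2
     + (\<Sum>i<N. (wnorm Q (traj A B x \<mu> i - xbar G v))\<^sup>2 + (wnorm R (\<mu> i - ubar G v))\<^sup>2)"

definition ocp_domain ::
  "real^'nx^'nx \<Rightarrow> real^'nu^'nx \<Rightarrow> real^'nx^'ny \<Rightarrow> real^'nu^'ny \<Rightarrow> (real^'ny) set
     \<Rightarrow> nat \<Rightarrow> ((real^'nx) \<times> (real^'nv)) set \<Rightarrow> ((real^'nx) \<times> (real^'nv)) set" where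
  "ocp_domain A B C D Y N T = {(x, v). ocp_feasible A B C D Y N T x v \<noteq> {}}"

text \<open>The first element of the minimizer; meaningful on \<open>ocp_domain\<close> only.\<close>

definition mpc_law ::
  "real^'nx^'nx \<Rightarrow> real^'nu^'nx \<Rightarrow> real^'nx^'ny \<Rightarrow> real^'nu^'ny
     \<Rightarrow> real^'nv^('nx::finite + 'nu::finite + 'nz::finite) \<Rightarrow> (real^'ny) set \<Rightarrow> nat \<Rightarrow> ((real^'nx) \<times> (real^'nv)) set
     \<Rightarrow> real^'nx^'nx \<Rightarrow> real^'nx^'nx \<Rightarrow> real^'nu^'nu \<Rightarrow> real^'nx \<Rightarrow> real^'nv \<Rightarrow> real^'nu" where
  "mpc_law A B C D G Y N T P Q R x v =
     arg_min_on (ocp_cost A B G N P Q R x v) (ocp_feasible A B C D Y N T x v) 0"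

definition closed_loop ::
  "real^'nx^'nx \<Rightarrow> real^'nu^'nx \<Rightarrow> real^'nx^'ny \<Rightarrow> real^'nu^'ny
     \<Rightarrow> real^'nv^('nx::finite + 'nu::finite + 'nz::finite) \<Rightarrow> (real^'ny) set \<Rightarrow> nat \<Rightarrow> ((real^'nx) \<times> (real^'nv)) set
     \<Rightarrow> real^'nx^'nx \<Rightarrow> real^'nx^'nx \<Rightarrow> real^'nu^'nu \<Rightarrow> real^'nx \<Rightarrow> real^'nv \<Rightarrow> real^'nx" where
  "closed_loop A B C D G Y N T P Q R x v = A *v x + B *v mpc_law A B C D G Y N T P Q R x v"

definition gov_cost ::
  "real^'nv^('nx::finite + 'nu::finite + 'nz::finite) \<Rightarrow> real^'nv \<Rightarrow> real^'nz \<Rightarrow> real^'nv \<Rightarrow> real" where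
  "gov_cost G vs r v =
     (if inj ((*v) (Gz G)) then (norm (Gz G *v v - r))\<^sup>2 else (norm (v - vs))\<^sup>2)"

text \<open>In the following definitions \<open>V\<close> is the set of admissible references and \<open>\<Gamma>\<close> the domain
  of the optimal control problem.\<close>

definition gov_Phi ::
  "((real^'nx) \<times> (real^'nv)) set \<Rightarrow> (real^'nv) set \<Rightarrow> ((real^'nx) \<times> (real^'nv)) set" where
  "gov_Phi \<F> V = \<F> \<inter> (UNIV \<times> V)"

definition gov_Lambda ::
  "((real^'nx) \<times> (real^'nv)) set \<Rightarrow> (real^'nv) set \<Rightarrow> ((real^'nx) \<times> (real^'nv)) set" where
  "gov_Lambda \<Gamma> V = \<Gamma> \<inter> (UNIV \<times> V)"

definition gov_gbar ::
  "real^'nv^('nx::finite + 'nu::finite + 'nz::finite) \<Rightarrow> ((real^'nx) \<times> (real^'nv)) set \<Rightarrow> (real^'nv) set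
     \<Rightarrow> real^'nv \<Rightarrow> real^'nz \<Rightarrow> real^'nx \<Rightarrow> real^'nv" where
  "gov_gbar G \<F> V vs r x = arg_min_on (gov_cost G vs r) {v. (x, v) \<in> gov_Phi \<F> V}"

definition gov_g ::
  "real^'nv^('nx::finite + 'nu::finite + 'nz::finite) \<Rightarrow> ((real^'nx) \<times> (real^'nv)) set \<Rightarrow> ((real^'nx) \<times> (real^'nv)) set
     \<Rightarrow> (real^'nv) set \<Rightarrow> real^'nv \<Rightarrow> real^'nz \<Rightarrow> real^'nx \<Rightarrow> real^'nv \<Rightarrow> real^'nv" where
  "gov_g G \<Gamma> \<F> V vs r x v =
     (if (x, v) \<in> gov_Phi \<F> V then gov_gbar G \<F> V vs r x
      else if (x, v) \<in> gov_Lambda \<Gamma> V then v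
      else undefined)"

end

theory Submission
  imports Defs
begin

text \<open>
  Let \<open>\<psi>\<close> be the governor cost. The reference changes only if the new one minimizes \<open>\<psi>\<close> over a convex
  set that contains the old one, so \<open>\<psi> (v k)\<close> decreases to a limit. Since \<open>\<psi>\<close> is the squared distance
  to a point under an injective linear map, the decrement dominates the squared
  increment of the reference, and the increments tend to zero.

  For a slowly varying reference the predictive controller brings the state close to the current
  steady state at arbitrarily late times (\<open>tracking_error_frequently_small\<close>). The Lyapunov function
  is the optimal cost, which decreases by the stage cost along the closed loop. Two estimates
  are required that hold up to the boundary of the feasible set and without
  boundedness: the optimal cost is at most quadratic in the tracking error, and a change of the
  reference by \<open>d\<close> turns it into at most \<open>(1 + \<theta>) J + (1 + 1/\<theta>) c d\<^sup>2\<close> for every \<open>\<theta> > 0\<close>. Both follow from a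
  Lipschitz estimate for the feasible inputs as a function of state and reference
  (\<open>feasible_inputs_lipschitz\<close>), a Hoffman bound that holds because all constraints are polyhedral and
  that is obtained by Fourier--Motzkin elimination along the horizon. Observability bounds the error by the
  stage costs over a window, and the elementary lemma \<open>perturbed_descent_window_vanishes\<close> concludes.

  The steady states that belong to the sublevel set of the initial reference form a compact subset
  of the interior of \<open>\<F>\<close>, so they have a uniform margin. Whenever the state is
  within this margin of the current steady state, the governor may move the reference a fixed
  fraction of the way towards \<open>vs\<close>, which lowers \<open>\<psi>\<close> by a fixed amount unless \<open>vs\<close> itself lies within reach.
  At late times the decrements of \<open>\<psi>\<close> are smaller than this amount. Hence \<open>vs\<close> is within reach and is
  selected, and it is kept because it is the only minimizer (\<open>governor_reaches_optimum\<close>).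
\<close>

section \<open>Projections and sections of polyhedra\<close>

text \<open>
  Inequalities with a zero normal vector are admitted, so that linear preimages and eliminations
  produce a description of the same kind without a case distinction.
\<close>
lemma polyhedron_finite_inequalities:
  fixes S :: "'a::euclidean_space set"
  shows "polyhedron S \<longleftrightarrow> (\<exists>I. finite I \<and> S = {x. \<forall>i\<in>I. fst i \<bullet> x \<le> snd i})"
proof
  assume "polyhedron S"
  then obtain F where F: "finite F" "S = \<Inter>F" "\<forall>h\<in>F. \<exists>a b. a \<noteq> 0 \<and> h = {x. a \<bullet> x \<le> b}"
    unfolding polyhedron_def by blast
  from F(3) obtain a b where ab: "\<And>h. h \<in> F \<Longrightarrow> h = {x. a h \<bullet> x \<le> b h}"
    by metis
  have "S = {x. \<forall>i\<in>(\<lambda>h. (a h, b h)) ` F. fst i \<bullet> x \<le> snd i}"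
    using F(2) ab by auto
  with F(1) show "\<exists>I. finite I \<and> S = {x. \<forall>i\<in>I. fst i \<bullet> x \<le> snd i}"
    by blast
next
  assume "\<exists>I. finite I \<and> S = {x. \<forall>i\<in>I. fst i \<bullet> x \<le> snd i}"
  then obtain I where I: "finite I" "S = {x. \<forall>i\<in>I. fst i \<bullet> x \<le> snd i}" by blast
  have "S = \<Inter>((\<lambda>i. {x. fst i \<bullet> x \<le> snd i}) ` I)" using I(2) by auto
  then show "polyhedron S"
    using I(1) by (auto simp: polyhedron_halfspace_le intro!: polyhedron_Inter)
qed

lemma polyhedron_linear_vimage:
  fixes f :: "'a::euclidean_space \<Rightarrow> 'b::euclidean_space"
  assumes "linear f" "polyhedron S"
  shows "polyhedron (f -` S)"
proof -
  obtain I where I: "finite I" "S = {x. \<forall>i\<in>I. fst i \<bullet> x \<le> snd i}"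
    using assms(2) polyhedron_finite_inequalities by blast
  have "f -` S = {x. \<forall>i\<in>(\<lambda>i. (adjoint f (fst i), snd i)) ` I. fst i \<bullet> x \<le> snd i}"
    using I(2) adjoint_clauses(2)[OF assms(1)] by simp
  with I(1) show ?thesis
    unfolding polyhedron_finite_inequalities by blast
qed

lemma finite_sets_separated:
  fixes L U :: "'a::linorder set"
  assumes "finite L" "finite U" "\<And>l u. l \<in> L \<Longrightarrow> u \<in> U \<Longrightarrow> l \<le> u"
  obtains t where "\<And>l. l \<in> L \<Longrightarrow> l \<le> t" "\<And>u. u \<in> U \<Longrightarrow> t \<le> u"
proof (cases "L = {}")
  case True
  then show ?thesis using that assms(2) by (cases "U = {}") (auto intro: Min_le)
next
  case False
  then show ?thesis using that[of "Max L"] assms by auto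
qed

text \<open>
  One step of Fourier--Motzkin elimination along \<open>e\<close>. Each inequality with a nonzero slope along
  \<open>e\<close> bounds the shift \<open>t\<close> from one side, and a suitable \<open>t\<close> exists iff every lower bound lies
  below every upper bound, which is again a finite system of linear inequalities in \<open>z\<close>.
\<close>
lemma polyhedron_line_sum:
  fixes S :: "'a::euclidean_space set"
  assumes "polyhedron S"
  shows "polyhedron {z. \<exists>t. z + t *\<^sub>R e \<in> S}"
proof -
  obtain I where I: "finite I" "S = {x. \<forall>i\<in>I. fst i \<bullet> x \<le> snd i}"
    using assms polyhedron_finite_inequalities by blast
  define s where "s i = fst i \<bullet> e" for i :: "'a \<times> real"
  define I0 where "I0 = {i\<in>I. s i = 0}"
  define Ip where "Ip = {i\<in>I. s i > 0}"
  define Im where "Im = {i\<in>I. s i < 0}"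
  define comb where "comb p = (fst (fst p) /\<^sub>R s (fst p) - fst (snd p) /\<^sub>R s (snd p),
      snd (fst p) / s (fst p) - snd (snd p) / s (snd p))" for p
  define J where "J = I0 \<union> comb ` (Ip \<times> Im)"
  define q where "q z i = (snd i - fst i \<bullet> z) / s i" for z i
  have fin: "finite Ip" "finite Im" "finite J"
    using I(1) by (auto simp: Ip_def Im_def J_def I0_def)
  have split: "I = I0 \<union> Ip \<union> Im" by (auto simp: I0_def Ip_def Im_def)
  have mem: "z + t *\<^sub>R e \<in> S \<longleftrightarrow> (\<forall>i\<in>I0. fst i \<bullet> z \<le> snd i)
      \<and> (\<forall>i\<in>Ip. t \<le> q z i) \<and> (\<forall>i\<in>Im. q z i \<le> t)" for z t
  proof -
    have "fst i \<bullet> (z + t *\<^sub>R e) = fst i \<bullet> z + t * s i" for i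
      by (simp add: s_def inner_add_right)
    then have "z + t *\<^sub>R e \<in> S \<longleftrightarrow> (\<forall>i\<in>I0 \<union> Ip \<union> Im. fst i \<bullet> z + t * s i \<le> snd i)"
      using I(2) split by auto
    moreover have "fst i \<bullet> z + t * s i \<le> snd i \<longleftrightarrow> fst i \<bullet> z \<le> snd i" if "i \<in> I0" for i
      using that by (simp add: I0_def)
    moreover have "fst i \<bullet> z + t * s i \<le> snd i \<longleftrightarrow> t \<le> q z i" if "i \<in> Ip" for i
      using that by (auto simp: Ip_def q_def pos_le_divide_eq)
    moreover have "fst i \<bullet> z + t * s i \<le> snd i \<longleftrightarrow> q z i \<le> t" if "i \<in> Im" for i
      using that by (auto simp: Im_def q_def neg_divide_le_eq)
    ultimately show ?thesis by blast
  qed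
  have comb: "fst (comb (i,j)) \<bullet> z \<le> snd (comb (i,j)) \<longleftrightarrow> q z j \<le> q z i" for z i j
  proof -
    have "fst (comb (i,j)) \<bullet> z = fst i \<bullet> z / s i - fst j \<bullet> z / s j"
      by (simp add: comb_def inner_diff_left divide_inverse mult.commute)
    moreover have "snd (comb (i,j)) = snd i / s i - snd j / s j" by (simp add: comb_def)
    ultimately show ?thesis unfolding q_def diff_divide_distrib by linarith
  qed
  have "{z. \<exists>t. z + t *\<^sub>R e \<in> S} = {z. \<forall>i\<in>J. fst i \<bullet> z \<le> snd i}"
  proof (intro Collect_cong iffI)
    fix z assume "\<exists>t. z + t *\<^sub>R e \<in> S"
    then obtain t where t: "\<And>i. i \<in> I0 \<Longrightarrow> fst i \<bullet> z \<le> snd i" "\<And>i. i \<in> Ip \<Longrightarrow> t \<le> q z i"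
        "\<And>i. i \<in> Im \<Longrightarrow> q z i \<le> t"
      unfolding mem by blast
    have "fst (comb (i, j)) \<bullet> z \<le> snd (comb (i, j))" if "i \<in> Ip" "j \<in> Im" for i j
      unfolding comb using t(2,3) that by (meson order_trans)
    with t(1) show "\<forall>i\<in>J. fst i \<bullet> z \<le> snd i" unfolding J_def by blast
  next
    fix z assume z: "\<forall>i\<in>J. fst i \<bullet> z \<le> snd i"
    then have "l \<le> u" if "l \<in> q z ` Im" "u \<in> q z ` Ip" for l u
      using that comb unfolding J_def by blast
    then obtain t where "\<And>l. l \<in> q z ` Im \<Longrightarrow> l \<le> t" "\<And>u. u \<in> q z ` Ip \<Longrightarrow> t \<le> u"
      using finite_sets_separated[of "q z ` Im" "q z ` Ip"] fin by blast
    then show "\<exists>t. z + t *\<^sub>R e \<in> S" unfolding mem using z J_def by blast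
  qed
  with fin(3) show ?thesis unfolding polyhedron_finite_inequalities by blast
qed

text \<open>
  The least shift along \<open>e\<close> that repairs \<open>z'\<close> is dictated by one inequality that \<open>z'\<close> violates.
  As \<open>z\<close> satisfies this inequality, the violation is at most proportional to the distance of \<open>z'\<close>
  from \<open>z\<close>. Inequalities that get worse along \<open>e\<close> still hold at the least shift because they hold at
  the longer shift \<open>t\<close>.
\<close>
lemma polyhedron_line_lipschitz_nonneg:
  fixes S :: "'a::euclidean_space set"
  assumes "polyhedron S"
  obtains L where "L \<ge> 0" "\<And>z z' t. z \<in> S \<Longrightarrow> t \<ge> 0 \<Longrightarrow> z' + t *\<^sub>R e \<in> S \<Longrightarrow>
      \<exists>t'. z' + t' *\<^sub>R e \<in> S \<and> \<bar>t'\<bar> \<le> L * norm (z' - z)"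
proof -
  obtain I where I: "finite I" "S = {x. \<forall>i\<in>I. fst i \<bullet> x \<le> snd i}"
    using assms polyhedron_finite_inequalities by blast
  define Im where "Im = {i\<in>I. fst i \<bullet> e < 0}"
  have finm: "finite Im" using I(1) by (simp add: Im_def)
  define L where "L = (\<Sum>i\<in>Im. norm (fst i) / - (fst i \<bullet> e))"
  have L0: "L \<ge> 0" unfolding L_def Im_def by (rule sum_nonneg) (auto simp: divide_nonneg_neg)
  have "\<exists>t'. z' + t' *\<^sub>R e \<in> S \<and> \<bar>t'\<bar> \<le> L * norm (z' - z)"
    if z: "z \<in> S" and t: "t \<ge> 0" and zt: "z' + t *\<^sub>R e \<in> S" for z z' t
  proof -
    \<comment> \<open>the least shift that satisfies the inequalities which improve along \<open>e\<close>\<close>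
    define q where "q i = (fst i \<bullet> z' - snd i) / - (fst i \<bullet> e)" for i
    define t' where "t' = Max (insert 0 (q ` Im))"
    have t'_ge: "0 \<le> t'" "\<And>i. i \<in> Im \<Longrightarrow> q i \<le> t'"
      using finm by (auto simp: t'_def)
    have qt: "q i \<le> t" if "i \<in> Im" for i
    proof -
      have "fst i \<bullet> z' + t * (fst i \<bullet> e) \<le> snd i"
        using zt that I(2) by (auto simp: Im_def inner_add_right)
      then show ?thesis using that by (simp add: q_def Im_def pos_divide_le_eq field_simps)
    qed
    have t'_le: "t' \<le> t" using finm t qt by (auto simp: t'_def)
    have qL: "q i \<le> L * norm (z' - z)" if "i \<in> Im" for i
    proof -
      have neg: "fst i \<bullet> e < 0" and "fst i \<bullet> z \<le> snd i" using that z I(2) by (auto simp: Im_def)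
      then have "fst i \<bullet> z' - snd i \<le> fst i \<bullet> (z' - z)" by (simp add: inner_diff_right)
      also have "\<dots> \<le> norm (fst i) * norm (z' - z)" by (rule norm_cauchy_schwarz)
      finally have "q i \<le> norm (fst i) * norm (z' - z) / - (fst i \<bullet> e)"
        unfolding q_def using neg by (intro divide_right_mono) auto
      also have "\<dots> = norm (fst i) / - (fst i \<bullet> e) * norm (z' - z)" by simp
      also have "\<dots> \<le> L * norm (z' - z)"
        unfolding L_def using finm that
        by (intro mult_right_mono member_le_sum) (auto simp: Im_def divide_nonneg_neg)
      finally show ?thesis .
    qed
    have "t' \<le> L * norm (z' - z)" using finm qL L0 by (auto simp: t'_def)
    moreover have "z' + t' *\<^sub>R e \<in> S"
      unfolding I(2)
    proof (intro CollectI ballI)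
      fix i assume i: "i \<in> I"
      have zi: "fst i \<bullet> z' + t * (fst i \<bullet> e) \<le> snd i"
        using zt i I(2) by (auto simp: inner_add_right)
      show "fst i \<bullet> (z' + t' *\<^sub>R e) \<le> snd i"
      proof (cases "fst i \<bullet> e < 0")
        case True
        then have "q i \<le> t'" using i t'_ge by (simp add: Im_def)
        then show ?thesis using True by (simp add: q_def pos_divide_le_eq inner_add_right field_simps)
      next
        case False
        then have "t' * (fst i \<bullet> e) \<le> t * (fst i \<bullet> e)" using t'_le by (intro mult_right_mono) auto
        then show ?thesis using zi by (simp add: inner_add_right)
      qed
    qed
    ultimately show ?thesis using t'_ge(1) by auto
  qed
  with L0 that show ?thesis by blast
qed

lemma polyhedron_line_lipschitz:
  fixes S :: "'a::euclidean_space set"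
  assumes "polyhedron S"
  obtains L where "L \<ge> 0" "\<And>z z' t. z \<in> S \<Longrightarrow> z' + t *\<^sub>R e \<in> S \<Longrightarrow>
      \<exists>t'. z' + t' *\<^sub>R e \<in> S \<and> norm (z' + t' *\<^sub>R e - z) \<le> L * norm (z' - z)"
proof -
  obtain L1 where L1: "L1 \<ge> 0" "\<And>z z' t. z \<in> S \<Longrightarrow> t \<ge> 0 \<Longrightarrow> z' + t *\<^sub>R e \<in> S \<Longrightarrow>
      \<exists>t'. z' + t' *\<^sub>R e \<in> S \<and> \<bar>t'\<bar> \<le> L1 * norm (z' - z)"
    using polyhedron_line_lipschitz_nonneg[OF assms] by blast
  obtain L2 where L2: "L2 \<ge> 0" "\<And>z z' t. z \<in> S \<Longrightarrow> t \<ge> 0 \<Longrightarrow> z' + t *\<^sub>R (- e) \<in> S \<Longrightarrow>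
      \<exists>t'. z' + t' *\<^sub>R (- e) \<in> S \<and> \<bar>t'\<bar> \<le> L2 * norm (z' - z)"
    using polyhedron_line_lipschitz_nonneg[OF assms] by blast
  define L where "L = 1 + (L1 + L2) * norm e"
  have "\<exists>t'. z' + t' *\<^sub>R e \<in> S \<and> norm (z' + t' *\<^sub>R e - z) \<le> L * norm (z' - z)"
    if z: "z \<in> S" "z' + t *\<^sub>R e \<in> S" for z z' t
  proof -
    have "\<exists>t'. z' + t' *\<^sub>R e \<in> S \<and> \<bar>t'\<bar> \<le> (L1 + L2) * norm (z' - z)"
    proof (cases "t \<ge> 0")
      case True
      then obtain t' where t': "z' + t' *\<^sub>R e \<in> S" "\<bar>t'\<bar> \<le> L1 * norm (z' - z)"
        using L1(2) z by blast
      moreover have "L1 * norm (z' - z) \<le> (L1 + L2) * norm (z' - z)"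
        using L2(1) by (intro mult_right_mono) auto
      ultimately show ?thesis by force
    next
      case False
      then have "-t \<ge> 0" "z' + (-t) *\<^sub>R (- e) \<in> S" using z by auto
      then obtain t' where t': "z' + t' *\<^sub>R (-e) \<in> S" "\<bar>t'\<bar> \<le> L2 * norm (z' - z)"
        using L2(2) z by blast
      moreover have "L2 * norm (z' - z) \<le> (L1 + L2) * norm (z' - z)"
        using L1(1) by (intro mult_right_mono) auto
      moreover have "z' + (-t') *\<^sub>R e \<in> S" "\<bar>-t'\<bar> = \<bar>t'\<bar>" using t' by auto
      ultimately show ?thesis by (metis order_trans)
    qed
    then obtain t' where t': "z' + t' *\<^sub>R e \<in> S" "\<bar>t'\<bar> \<le> (L1 + L2) * norm (z' - z)" by blast
    have "norm (z' + t' *\<^sub>R e - z) \<le> norm (z' - z) + \<bar>t'\<bar> * norm e"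
      using norm_triangle_ineq[of "z' - z" "t' *\<^sub>R e"] by (simp add: algebra_simps)
    also have "\<dots> \<le> norm (z' - z) + (L1 + L2) * norm (z' - z) * norm e"
      using t'(2) by (intro add_left_mono mult_right_mono) auto
    finally show ?thesis using t'(1) by (auto simp: L_def algebra_simps)
  qed
  moreover have "L \<ge> 0" using L1(1) L2(1) by (simp add: L_def)
  ultimately show ?thesis using that by blast
qed

text \<open>
  A Hoffman bound by elimination: the spanning vectors are removed one at a time, every stage of the
  elimination is again a polyhedron, and the Lipschitz constants of the stages multiply.
\<close>
lemma polyhedron_span_sum_lipschitz:
  fixes S :: "'a::euclidean_space set"
  assumes "finite B" "polyhedron S"
  shows "polyhedron {z. \<exists>w\<in>span B. z + w \<in> S} \<and>
    (\<exists>L\<ge>0. \<forall>z z'. z \<in> S \<and> (\<exists>w\<in>span B. z' + w \<in> S) \<longrightarrow>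
      (\<exists>w\<in>span B. z' + w \<in> S \<and> norm (z' + w - z) \<le> L * norm (z' - z)))"
  using assms
proof (induction B arbitrary: S rule: finite_induct)
  case empty
  then show ?case by (auto intro!: exI[of _ 1])
next
  case (insert e B)
  define S' where "S' = {z. \<exists>t. z + t *\<^sub>R e \<in> S}"
  have S': "polyhedron S'" unfolding S'_def by (rule polyhedron_line_sum[OF insert.prems])
  obtain L1 where L1: "L1 \<ge> 0" "\<And>z z' t. z \<in> S \<Longrightarrow> z' + t *\<^sub>R e \<in> S \<Longrightarrow>
      \<exists>t'. z' + t' *\<^sub>R e \<in> S \<and> norm (z' + t' *\<^sub>R e - z) \<le> L1 * norm (z' - z)"
    using polyhedron_line_lipschitz[OF insert.prems] by blast
  obtain L2 where L2: "L2 \<ge> 0" "\<And>z z'. z \<in> S' \<Longrightarrow> (\<exists>w\<in>span B. z' + w \<in> S') \<Longrightarrow>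
      (\<exists>w\<in>span B. z' + w \<in> S' \<and> norm (z' + w - z) \<le> L2 * norm (z' - z))"
    using insert.IH[OF S'] by blast
  have into: "w + t *\<^sub>R e \<in> span (insert e B)" if "w \<in> span B" for w t
    by (metis add_diff_cancel_right' span_breakdown_eq that)
  have out: "\<exists>u\<in>span B. \<exists>t. w = u + t *\<^sub>R e" if "w \<in> span (insert e B)" for w
    using that unfolding span_breakdown_eq by (metis diff_add_cancel)
  have eq: "(\<exists>w\<in>span (insert e B). z + w \<in> S) \<longleftrightarrow> (\<exists>w\<in>span B. z + w \<in> S')" for z
  proof
    assume "\<exists>w\<in>span (insert e B). z + w \<in> S"
    then obtain u t where "u \<in> span B" "z + (u + t *\<^sub>R e) \<in> S" using out by blast
    then show "\<exists>w\<in>span B. z + w \<in> S'"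
      unfolding S'_def by (auto simp: add.assoc)
  next
    assume "\<exists>w\<in>span B. z + w \<in> S'"
    then obtain w t where "w \<in> span B" "z + (w + t *\<^sub>R e) \<in> S"
      unfolding S'_def by (auto simp: add.assoc)
    then show "\<exists>w\<in>span (insert e B). z + w \<in> S" using into by blast
  qed
  have "\<exists>w\<in>span (insert e B). z' + w \<in> S \<and> norm (z' + w - z) \<le> (L1 * L2) * norm (z' - z)"
    if z: "z \<in> S" "\<exists>w\<in>span (insert e B). z' + w \<in> S" for z z'
  proof -
    have "z \<in> S'" unfolding S'_def using z(1) by (auto intro!: exI[of _ 0])
    then obtain w where w: "w \<in> span B" "z' + w \<in> S'" "norm (z' + w - z) \<le> L2 * norm (z' - z)"
      using L2(2)[of z z'] z(2) unfolding eq by blast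
    then obtain t where "(z' + w) + t *\<^sub>R e \<in> S" unfolding S'_def by blast
    then obtain t' where t': "(z' + w) + t' *\<^sub>R e \<in> S"
        "norm ((z' + w) + t' *\<^sub>R e - z) \<le> L1 * norm (z' + w - z)"
      using L1(2) z(1) by blast
    have "L1 * norm (z' + w - z) \<le> L1 * (L2 * norm (z' - z))"
      using w(3) L1(1) by (rule mult_left_mono)
    then show ?thesis using t' into[OF w(1), of t'] by (intro bexI[of _ "w + t' *\<^sub>R e"]) (auto simp: add.assoc mult.assoc)
  qed
  moreover have "L1 * L2 \<ge> 0" using L1(1) L2(1) by simp
  moreover have "polyhedron {z. \<exists>w\<in>span (insert e B). z + w \<in> S}"
    unfolding eq using insert.IH[OF S'] by blast
  ultimately show ?case
    by (intro conjI exI[of _ "L1 * L2"] allI impI) (assumption, assumption, erule conjE, assumption)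
qed

lemma span_snd_Basis: "span (Pair (0::'a::euclidean_space) ` (Basis :: 'b::euclidean_space set)) = {0} \<times> UNIV"
proof -
  have "linear (Pair (0::'a) :: 'b \<Rightarrow> _)" by (auto intro!: linearI)
  then show ?thesis by (subst span_linear_image) auto
qed

lemma polyhedron_fst_image:
  fixes S :: "('a::euclidean_space \<times> 'b::euclidean_space) set"
  assumes "polyhedron S"
  shows "polyhedron (fst ` S)"
proof -
  let ?B = "Pair (0::'a) ` (Basis :: 'b set)"
  have B: "finite ?B" by simp
  have "fst ` S = (\<lambda>a. (a, 0)) -` {z. \<exists>w\<in>span ?B. z + w \<in> S}"
  proof (rule set_eqI)
    fix a
    have "a \<in> fst ` S \<longleftrightarrow> (\<exists>b. (a, b) \<in> S)" by force
    then show "a \<in> fst ` S \<longleftrightarrow> a \<in> (\<lambda>a. (a, 0)) -` {z. \<exists>w\<in>span ?B. z + w \<in> S}"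
      unfolding span_snd_Basis by simp
  qed
  moreover have "linear (\<lambda>a::'a. (a, 0::'b))" by (auto intro!: linearI)
  moreover have "polyhedron {z. \<exists>w\<in>span ?B. z + w \<in> S}"
    using polyhedron_span_sum_lipschitz[OF B assms] by blast
  ultimately show ?thesis using polyhedron_linear_vimage[of "\<lambda>a::'a. (a, 0::'b)" "{z. \<exists>w\<in>span ?B. z + w \<in> S}"] by simp
qed

text \<open>
  The sections of a polyhedron depend on the base point in a Lipschitz way, with one constant for
  the whole set, boundary and unbounded parts included. For a general closed convex set this fails,
  and here is the place where polyhedral constraints are essential.
\<close>
lemma polyhedron_section_lipschitz:
  fixes S :: "('a::euclidean_space \<times> 'b::euclidean_space) set"
  assumes "polyhedron S"
  obtains L where "L \<ge> 0" "\<And>a b a'. (a, b) \<in> S \<Longrightarrow> a' \<in> fst ` S \<Longrightarrow>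
      \<exists>b'. (a', b') \<in> S \<and> norm (b' - b) \<le> L * norm (a' - a)"
proof -
  let ?B = "Pair (0::'a) ` (Basis :: 'b set)"
  have B: "finite ?B" by simp
  obtain L where L: "L \<ge> 0" "\<And>z z'. z \<in> S \<Longrightarrow> (\<exists>w\<in>span ?B. z' + w \<in> S) \<Longrightarrow>
      (\<exists>w\<in>span ?B. z' + w \<in> S \<and> norm (z' + w - z) \<le> L * norm (z' - z))"
    using polyhedron_span_sum_lipschitz[OF B assms] by blast
  have "\<exists>b'. (a', b') \<in> S \<and> norm (b' - b) \<le> L * norm (a' - a)"
    if ab: "(a, b) \<in> S" "a' \<in> fst ` S" for a b a'
  proof -
    obtain c where "(a', c) \<in> S" using ab by auto
    then have "\<exists>w\<in>span ?B. (a', b) + w \<in> S"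
      unfolding span_snd_Basis by (auto intro!: exI[of _ "c - b"])
    then obtain w where w: "(a', b) + (0, w) \<in> S"
        "norm ((a', b) + (0, w) - (a, b)) \<le> L * norm ((a', b) - (a, b))"
      using L(2)[OF ab(1)] unfolding span_snd_Basis by blast
    have "norm w \<le> norm (a' - a, w)"
      using norm_snd_le[of w "a' - a"] by simp
    with w have "norm (b + w - b) \<le> L * norm (a' - a)"
      by (simp add: norm_Pair[of _ 0])
    with w(1) show ?thesis by auto
  qed
  with L(1) that show ?thesis by blast
qed

section \<open>Quadratic forms\<close>

lemma matrix_vector_norm_bound:
  fixes M :: "real^'n^'m"
  obtains c where "c \<ge> 1" "\<And>x. norm (M *v x) \<le> c * norm x"
proof -
  obtain b where "\<And>x. norm (M *v x) \<le> norm x * b"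
    using bounded_linear.bounded[OF matrix_vector_mul_bounded_linear, of M] by blast
  then have "norm (M *v x) \<le> max 1 b * norm x" for x
    by (metis max.cobounded2 mult.commute mult_right_mono norm_ge_zero order_trans)
  then show ?thesis using that[of "max 1 b"] by simp
qed

lemma wnorm_squared: "pos_semidef M \<Longrightarrow> (wnorm M x)\<^sup>2 = x \<bullet> (M *v x)"
  by (simp add: wnorm_def pos_semidef_def)

lemma pos_def_imp_pos_semidef: "pos_def M \<Longrightarrow> pos_semidef M"
  unfolding pos_def_def pos_semidef_def by (metis inner_zero_left less_imp_le order_refl)

lemma symmetric_mat_inner: "symmetric_mat M \<Longrightarrow> x \<bullet> (M *v y) = y \<bullet> (M *v x)"
  unfolding symmetric_mat_def
  by (metis dot_lmul_matrix inner_commute transpose_matrix_vector)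

text \<open>
  The Young inequality of a semidefinite form: the form is nonnegative at
  \<open>\<surd>\<theta> a - b / \<surd>\<theta>\<close>. The factor in front of the first term can be brought arbitrarily close
  to one, so that this perturbation estimate can be iterated.
\<close>
lemma wnorm_squared_add_le:
  assumes "symmetric_mat M" "pos_semidef M" "\<theta> > 0"
  shows "(wnorm M (a + b))\<^sup>2 \<le> (1 + \<theta>) * (wnorm M a)\<^sup>2 + (1 + 1/\<theta>) * (wnorm M b)\<^sup>2"
proof -
  define s where "s = sqrt \<theta>"
  have s: "s > 0" "s * s = \<theta>" using assms(3) by (auto simp: s_def)
  have "0 \<le> (s *\<^sub>R a - (1/s) *\<^sub>R b) \<bullet> (M *v (s *\<^sub>R a - (1/s) *\<^sub>R b))"
    using assms(2) by (simp add: pos_semidef_def)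
  also have "\<dots> = s * s * (a \<bullet> (M *v a)) - (s * (1/s)) * (a \<bullet> (M *v b)) - (s * (1/s)) * (b \<bullet> (M *v a))
      + (1/s) * (1/s) * (b \<bullet> (M *v b))"
    by (simp add: matrix_vector_mult_diff_distrib matrix_vector_mult_scaleR inner_diff_left
        inner_diff_right right_diff_distrib)
  also have "\<dots> = \<theta> * (a \<bullet> (M *v a)) - 2 * (a \<bullet> (M *v b)) + 1/\<theta> * (b \<bullet> (M *v b))"
    using s symmetric_mat_inner[OF assms(1), of b a] by simp
  finally have "2 * (a \<bullet> (M *v b)) \<le> \<theta> * (a \<bullet> (M *v a)) + 1/\<theta> * (b \<bullet> (M *v b))" by simp
  moreover have "(a + b) \<bullet> (M *v (a + b)) = a \<bullet> (M *v a) + 2 * (a \<bullet> (M *v b)) + b \<bullet> (M *v b)"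
    using symmetric_mat_inner[OF assms(1), of b a]
    by (simp add: matrix_vector_right_distrib inner_add_left inner_add_right)
  ultimately show ?thesis
    unfolding wnorm_squared[OF assms(2)] distrib_right by simp
qed

lemma wnorm_squared_le_norm:
  assumes "pos_semidef M"
  obtains c where "c \<ge> 1" "\<And>x. (wnorm M x)\<^sup>2 \<le> c * (norm x)\<^sup>2"
proof -
  obtain c where c: "c \<ge> 1" "\<And>x. norm (M *v x) \<le> c * norm x"
    using matrix_vector_norm_bound by blast
  have "(wnorm M x)\<^sup>2 \<le> c * (norm x)\<^sup>2" for x
  proof -
    have "x \<bullet> (M *v x) \<le> norm x * norm (M *v x)" by (rule norm_cauchy_schwarz)
    also have "\<dots> \<le> norm x * (c * norm x)" using c by (intro mult_left_mono) auto
    finally show ?thesis unfolding wnorm_squared[OF assms] by (simp add: power2_eq_square mult_ac)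
  qed
  with c that show ?thesis by blast
qed

lemma norm_squared_le_wnorm:
  fixes R :: "real^'n^'n"
  assumes "pos_def R"
  obtains c where "c \<ge> 1" "\<And>x. (norm x)\<^sup>2 \<le> c * (wnorm R x)\<^sup>2"
proof -
  have psd: "pos_semidef R" using assms by (rule pos_def_imp_pos_semidef)
  have "continuous_on (sphere 0 1) (\<lambda>x::real^'n. x \<bullet> (R *v x))"
    by (intro continuous_intros)
  moreover have "sphere (0::real^'n) 1 \<noteq> {}" by simp
  ultimately have "\<exists>x0\<in>sphere (0::real^'n) 1. \<forall>x\<in>sphere 0 1. x0 \<bullet> (R *v x0) \<le> x \<bullet> (R *v x)"
    by (intro continuous_attains_inf compact_sphere)
  then obtain x0 where x0: "norm (x0::real^'n) = 1"
      "\<And>x. norm x = 1 \<Longrightarrow> x0 \<bullet> (R *v x0) \<le> x \<bullet> (R *v x)"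
    by auto
  define \<mu> where "\<mu> = x0 \<bullet> (R *v x0)"
  have \<mu>: "\<mu> > 0" using assms x0(1) unfolding pos_def_def \<mu>_def by (metis norm_zero zero_neq_one)
  have "\<mu> * (norm x)\<^sup>2 \<le> x \<bullet> (R *v x)" for x
  proof (cases "x = 0")
    case False
    have "\<mu> \<le> (x /\<^sub>R norm x) \<bullet> (R *v (x /\<^sub>R norm x))"
      unfolding \<mu>_def using False by (intro x0(2)) simp
    also have "\<dots> = (x \<bullet> (R *v x)) / (norm x)\<^sup>2"
      by (simp only: matrix_vector_mult_scaleR inner_scaleR_left inner_scaleR_right
          power2_eq_square divide_inverse inverse_mult_distrib mult_ac)
    finally show ?thesis using False by (simp add: pos_le_divide_eq)
  qed simp
  then have "(norm x)\<^sup>2 \<le> max 1 (1/\<mu>) * (wnorm R x)\<^sup>2" for x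
  proof -
    have "(norm x)\<^sup>2 \<le> (1/\<mu>) * (wnorm R x)\<^sup>2"
      using \<open>\<And>x. \<mu> * (norm x)\<^sup>2 \<le> x \<bullet> (R *v x)\<close>[of x] \<mu>
      by (simp add: wnorm_squared[OF psd] field_simps)
    also have "\<dots> \<le> max 1 (1/\<mu>) * (wnorm R x)\<^sup>2" by (intro mult_right_mono) auto
    finally show ?thesis .
  qed
  then show ?thesis using that[of "max 1 (1/\<mu>)"] by simp
qed

text \<open>
  The form is nonnegative at \<open>b x - Q x\<close>, where \<open>b\<close> bounds the form from above.
\<close>
lemma norm_mult_squared_le_wnorm:
  assumes "symmetric_mat Q" "pos_semidef Q"
  obtains c where "c \<ge> 1" "\<And>x. (norm (Q *v x))\<^sup>2 \<le> c * (wnorm Q x)\<^sup>2"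
proof -
  obtain b where b: "b \<ge> 1" "\<And>x. (wnorm Q x)\<^sup>2 \<le> b * (norm x)\<^sup>2"
    using wnorm_squared_le_norm[OF assms(2)] by blast
  have "(norm (Q *v x))\<^sup>2 \<le> b * (wnorm Q x)\<^sup>2" for x
  proof -
    define y where "y = Q *v x"
    have y: "(wnorm Q y)\<^sup>2 \<le> b * (y \<bullet> y)" using b(2)[of y] by (simp add: power2_norm_eq_inner)
    \<comment> \<open>with the step \<open>1 / b\<close> the quadratic term absorbs half of the cross term\<close>
    have "0 \<le> (b *\<^sub>R x - y) \<bullet> (Q *v (b *\<^sub>R x - y))"
      using assms(2) by (simp add: pos_semidef_def)
    also have "\<dots> = b * b * (x \<bullet> (Q *v x)) - b * (x \<bullet> (Q *v y)) - b * (y \<bullet> (Q *v x)) + y \<bullet> (Q *v y)"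
      by (simp add: matrix_vector_mult_diff_distrib matrix_vector_mult_scaleR inner_diff_left
        inner_diff_right right_diff_distrib)
    also have "\<dots> = b * b * (wnorm Q x)\<^sup>2 - 2 * b * (y \<bullet> y) + (wnorm Q y)\<^sup>2"
      using symmetric_mat_inner[OF assms(1), of x y]
      by (simp add: wnorm_squared[OF assms(2)] y_def[symmetric])
    also have "\<dots> \<le> b * b * (wnorm Q x)\<^sup>2 - b * (y \<bullet> y)" using y by simp
    finally have "b * (y \<bullet> y) \<le> b * (b * (wnorm Q x)\<^sup>2)" by (simp add: mult.assoc)
    then have "y \<bullet> y \<le> b * (wnorm Q x)\<^sup>2" using b(1) by simp
    then show ?thesis by (simp add: y_def power2_norm_eq_inner)
  qed
  with b(1) that show ?thesis by blast
qed

section \<open>Observability over a finite window\<close>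

lemma linear_matrix_iterate: "linear (((*v) (A::real^'n^'n)) ^^ k)"
proof (induction k)
  case 0
  then show ?case by (simp add: linear_id[unfolded id_def] id_def)
next
  case (Suc k)
  then show ?case using linear_compose[OF Suc matrix_vector_mul_linear[of A]] by (simp only: funpow.simps)
qed

text \<open>
  Observability uses infinitely many outputs. By compactness of the unit sphere finitely many of
  them suffice, and their sum is bounded below on the sphere.
\<close>
lemma observable_imp_injective_window:
  fixes A :: "real^'n^'n" and H :: "real^'n^'p"
  assumes "observable A H"
  obtains m c where "c \<ge> 0" "\<And>x. norm x \<le> c * (\<Sum>i<m. norm (H *v (((*v) A ^^ i) x)))"
proof -
  have cont: "continuous_on S (\<lambda>x. norm (H *v (((*v) A ^^ i) x)))" for i S
    by (intro continuous_intros linear_continuous_on_compose[OF _ linear_matrix_iterate, unfolded o_def]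
        linear_continuous_on_compose[OF _ matrix_vector_mul_linear, unfolded o_def])
  let ?U = "\<lambda>i. {x. norm (H *v (((*v) A ^^ i) x)) > 0}"
  have zero: "((*v) A ^^ k) 0 = 0" for k using linear_0[OF linear_matrix_iterate] .
  have cover: "sphere 0 1 \<subseteq> (\<Union>i\<in>UNIV. ?U i)"
  proof
    fix x :: "real^'n" assume "x \<in> sphere 0 1"
    then have "x \<noteq> 0" by auto
    then obtain k where "H *v (((*v) A ^^ k) x) \<noteq> H *v (((*v) A ^^ k) 0)"
      using assms unfolding observable_def by blast
    then show "x \<in> (\<Union>i\<in>UNIV. ?U i)" by (auto simp: zero)
  qed
  have "open (?U i)" for i
    by (rule open_Collect_less[OF continuous_on_const cont])
  then obtain I where I: "finite I" "sphere 0 1 \<subseteq> (\<Union>i\<in>I. ?U i)"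
    using compactE_image[OF compact_sphere, of UNIV ?U] cover by (metis (no_types, lifting))
  obtain m where m: "I \<subseteq> {..<m}" using finite_nat_bounded[OF I(1)] by blast
  define f where "f x = (\<Sum>i<m. norm (H *v (((*v) A ^^ i) x)))" for x
  have "continuous_on (sphere 0 1) f" unfolding f_def by (intro continuous_on_sum cont)
  moreover have "sphere (0::real^'n) 1 \<noteq> {}" by simp
  ultimately have "\<exists>x0\<in>sphere 0 1. \<forall>x\<in>sphere 0 1. f x0 \<le> f x"
    by (intro continuous_attains_inf compact_sphere)
  then obtain x0 where x0: "norm x0 = 1" "\<And>x. norm x = 1 \<Longrightarrow> f x0 \<le> f x" by auto
  obtain i where i: "i \<in> I" "norm (H *v (((*v) A ^^ i) x0)) > 0" using I(2) x0(1) by auto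
  have "norm (H *v (((*v) A ^^ i) x0)) \<le> f x0"
    unfolding f_def using i(1) m by (intro member_le_sum) auto
  with i(2) have pos: "f x0 > 0" by linarith
  have scale: "f (a *\<^sub>R x) = \<bar>a\<bar> * f x" for a x
    by (simp add: f_def linear_cmul[OF linear_matrix_iterate] matrix_vector_mult_scaleR sum_distrib_left)
  have "norm x \<le> (1 / f x0) * f x" for x
  proof (cases "x = 0")
    case False
    then have "f x0 \<le> f (x /\<^sub>R norm x)" by (intro x0(2)) simp
    then show ?thesis using False pos by (simp add: scale field_simps)
  qed (simp add: f_def zero)
  then show ?thesis using that[of "1 / f x0" m] pos unfolding f_def by simp
qed

lemma perturbed_iterate_deviation:
  fixes A :: "real^'n^'n"
  assumes "a \<ge> 1" "\<And>x. norm (A *v x) \<le> a * norm x" "\<And>i. \<delta> (Suc i) = A *v \<delta> i + e i"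
  shows "norm (\<delta> i - ((*v) A ^^ i) (\<delta> 0)) \<le> a ^ i * (\<Sum>j<i. norm (e j))"
proof (induction i)
  case (Suc i)
  have "\<delta> (Suc i) - ((*v) A ^^ Suc i) (\<delta> 0) = A *v (\<delta> i - ((*v) A ^^ i) (\<delta> 0)) + e i"
    by (simp add: assms(3) matrix_vector_mult_diff_distrib)
  then have "norm (\<delta> (Suc i) - ((*v) A ^^ Suc i) (\<delta> 0))
      \<le> norm (A *v (\<delta> i - ((*v) A ^^ i) (\<delta> 0))) + norm (e i)"
    by (simp only: norm_triangle_ineq)
  also have "\<dots> \<le> a * norm (\<delta> i - ((*v) A ^^ i) (\<delta> 0)) + norm (e i)"
    by (intro add_right_mono assms(2))
  also have "\<dots> \<le> a * (a ^ i * (\<Sum>j<i. norm (e j))) + a ^ Suc i * norm (e i)"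
  proof (rule add_mono)
    show "a * norm (\<delta> i - ((*v) A ^^ i) (\<delta> 0)) \<le> a * (a ^ i * (\<Sum>j<i. norm (e j)))"
      using Suc assms(1) by (intro mult_left_mono) auto
    have "1 \<le> a ^ Suc i" using assms(1) by (rule one_le_power)
    then show "norm (e i) \<le> a ^ Suc i * norm (e i)"
      using mult_right_mono[of 1 "a ^ Suc i" "norm (e i)"] by simp
  qed
  finally show ?case by (simp only: sum.lessThan_Suc power_Suc distrib_left mult.assoc)
qed simp

text \<open>
  Robust form of observability: if the recursion \<open>\<delta>\<^sub>i\<^sub>+\<^sub>1 = A \<delta>\<^sub>i\<close> is disturbed by \<open>e\<^sub>i\<close>, then
  the outputs and the disturbances over a fixed window still control the initial value. It is
  used for the closed loop, where the disturbance collects the input deviation and the motion of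
  the reference, and for the terminal controller.
\<close>
lemma observable_window_estimate:
  fixes A :: "real^'n^'n" and H :: "real^'n^'p"
  assumes "observable A H"
  obtains m c where "c \<ge> 1" "\<And>\<delta> e. (\<And>i. \<delta> (Suc i) = A *v \<delta> i + e i) \<Longrightarrow>
      (norm (\<delta> 0))\<^sup>2 \<le> c * (\<Sum>i<m. (norm (H *v \<delta> i))\<^sup>2 + (norm (e i))\<^sup>2)"
proof -
  obtain c m where c: "c \<ge> 0" "\<And>x. norm x \<le> c * (\<Sum>i<m. norm (H *v (((*v) A ^^ i) x)))"
    by (rule observable_imp_injective_window[OF assms]) blast
  obtain a where a: "a \<ge> 1" "\<And>x. norm (A *v x) \<le> a * norm x"
    using matrix_vector_norm_bound by blast
  obtain h where h: "h \<ge> 1" "\<And>x. norm (H *v x) \<le> h * norm x"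
    using matrix_vector_norm_bound by blast
  define c1 where "c1 = 1 + real m * (h * a ^ m)"
  define C where "C = 1 + (c * c1)\<^sup>2 * real (card {..<m}) * 2"
  have c1: "c1 \<ge> 1" using h a by (simp add: c1_def)
  have "(norm (\<delta> 0))\<^sup>2 \<le> C * (\<Sum>i<m. (norm (H *v \<delta> i))\<^sup>2 + (norm (e i))\<^sup>2)"
    if \<delta>: "\<And>i. \<delta> (Suc i) = A *v \<delta> i + e i" for \<delta> e
  proof -
    define S where "S = (\<Sum>j<m. norm (e j))"
    have S: "S \<ge> 0" by (simp add: S_def sum_nonneg)
    have term_le: "norm (H *v (((*v) A ^^ i) (\<delta> 0))) \<le> norm (H *v \<delta> i) + h * a ^ m * S" if "i < m" for i
    proof -
      have "norm (\<delta> i - ((*v) A ^^ i) (\<delta> 0)) \<le> a ^ i * (\<Sum>j<i. norm (e j))"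
        by (rule perturbed_iterate_deviation[where \<delta> = \<delta> and e = e, OF a \<delta>])
      also have "\<dots> \<le> a ^ m * S"
        unfolding S_def using a(1) that
        by (intro mult_mono power_increasing sum_mono2) (auto intro: sum_nonneg)
      finally have "norm (H *v (\<delta> i - ((*v) A ^^ i) (\<delta> 0))) \<le> h * (a ^ m * S)"
        using h(2)[of "\<delta> i - ((*v) A ^^ i) (\<delta> 0)"] mult_left_mono[of _ "a ^ m * S" h] h(1)
        by (meson order_trans zero_le_one)
      then have "norm (H *v \<delta> i - H *v (((*v) A ^^ i) (\<delta> 0))) \<le> h * a ^ m * S"
        by (simp add: matrix_vector_mult_diff_distrib mult.assoc)
      then show ?thesis
        using norm_triangle_ineq2[of "H *v (((*v) A ^^ i) (\<delta> 0))" "H *v \<delta> i"]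
        by (simp add: norm_minus_commute)
    qed
    have "norm (\<delta> 0) \<le> c * (\<Sum>i<m. norm (H *v \<delta> i) + h * a ^ m * S)"
      by (rule order_trans[OF c(2) mult_left_mono[OF sum_mono c(1)]]) (simp add: term_le)
    also have "\<dots> = c * ((\<Sum>i<m. norm (H *v \<delta> i)) + (c1 - 1) * S)"
      by (simp add: sum.distrib c1_def)
    also have "\<dots> \<le> c * (c1 * (\<Sum>i<m. norm (H *v \<delta> i)) + c1 * S)"
    proof (intro mult_left_mono add_mono mult_right_mono c(1) S)
      show "(\<Sum>i<m. norm (H *v \<delta> i)) \<le> c1 * (\<Sum>i<m. norm (H *v \<delta> i))"
        using mult_right_mono[OF c1, of "\<Sum>i<m. norm (H *v \<delta> i)"] by (simp add: sum_nonneg)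
    qed simp
    also have "\<dots> = c * c1 * (\<Sum>i<m. norm (H *v \<delta> i) + norm (e i))"
      by (simp add: S_def sum.distrib algebra_simps)
    finally have "(norm (\<delta> 0))\<^sup>2 \<le> (c * c1 * (\<Sum>i<m. norm (H *v \<delta> i) + norm (e i)))\<^sup>2"
      by (rule power_mono) simp
    also have "\<dots> = (c * c1)\<^sup>2 * (\<Sum>i<m. norm (H *v \<delta> i) + norm (e i))\<^sup>2"
      by (rule power_mult_distrib)
    also have "\<dots> \<le> (c * c1)\<^sup>2 * ((\<Sum>i<m. (norm (H *v \<delta> i) + norm (e i))\<^sup>2) * real (card {..<m}))"
      by (intro mult_left_mono sum_squared_le_sum_of_squares) auto
    also have "\<dots> \<le> (c * c1)\<^sup>2 * ((\<Sum>i<m. 2 * ((norm (H *v \<delta> i))\<^sup>2 + (norm (e i))\<^sup>2)) * real (card {..<m}))"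
    proof (intro mult_left_mono mult_right_mono sum_mono)
      fix i show "(norm (H *v \<delta> i) + norm (e i))\<^sup>2 \<le> 2 * ((norm (H *v \<delta> i))\<^sup>2 + (norm (e i))\<^sup>2)"
        using sum_squares_bound[of "norm (H *v \<delta> i)" "norm (e i)"] by (simp add: power2_sum)
    qed auto
    also have "\<dots> = (C - 1) * (\<Sum>i<m. (norm (H *v \<delta> i))\<^sup>2 + (norm (e i))\<^sup>2)"
      by (simp only: sum_distrib_left[symmetric]) (simp add: C_def mult_ac)
    also have "\<dots> \<le> C * (\<Sum>i<m. (norm (H *v \<delta> i))\<^sup>2 + (norm (e i))\<^sup>2)"
      by (intro mult_right_mono sum_nonneg) auto
    finally show ?thesis .
  qed
  moreover have "C \<ge> 1" by (simp add: C_def)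
  ultimately show ?thesis using that by blast
qed

section \<open>Parameter dependence of the optimal control problem\<close>

lemma traj_equilibrium:
  "A *v x + B *v u = x \<Longrightarrow> (\<And>j. j < i \<Longrightarrow> \<mu> j = u) \<Longrightarrow> traj A B x \<mu> i = x"
  by (induction i) auto

lemma traj_shift: "traj A B (A *v x + B *v \<mu> 0) (\<lambda>i. \<mu> (Suc i)) i = traj A B x \<mu> (Suc i)"
  by (induction i) auto

lemma traj_cong: "(\<And>j. j < i \<Longrightarrow> \<mu> j = \<mu>' j) \<Longrightarrow> traj A B x \<mu> i = traj A B x \<mu>' i"
  by (induction i) auto

text \<open>
  Input sequences are undefined from the horizon on, so prepending an input by \<open>case_nat\<close> and
  dropping the first one keep them extensional.
\<close>
lemma ocp_feasible_Suc:
  "\<mu> \<in> ocp_feasible A B C D Y (Suc N) T x v \<longleftrightarrow>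
    C *v x + D *v \<mu> 0 \<in> Y \<and> (\<lambda>i. \<mu> (Suc i)) \<in> ocp_feasible A B C D Y N T (A *v x + B *v \<mu> 0) v"
proof -
  have "\<mu> \<in> {..<Suc N} \<rightarrow>\<^sub>E UNIV \<longleftrightarrow> (\<lambda>i. \<mu> (Suc i)) \<in> {..<N} \<rightarrow>\<^sub>E UNIV"
  proof
    assume "(\<lambda>i. \<mu> (Suc i)) \<in> {..<N} \<rightarrow>\<^sub>E UNIV"
    then have "\<mu> i = undefined" if "i \<ge> Suc N" for i
      using that by (cases i) (auto simp: PiE_iff extensional_def)
    then show "\<mu> \<in> {..<Suc N} \<rightarrow>\<^sub>E UNIV" by (auto simp: PiE_iff extensional_def)
  qed (auto simp: PiE_iff extensional_def)
  then show ?thesis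
    unfolding ocp_feasible_def mem_Collect_eq All_less_Suc2 traj_shift by (simp del: traj.simps(2)) blast
qed

lemma ocp_feasible_case_nat:
  "case_nat u \<mu> \<in> ocp_feasible A B C D Y (Suc N) T x v \<longleftrightarrow>
    C *v x + D *v u \<in> Y \<and> \<mu> \<in> ocp_feasible A B C D Y N T (A *v x + B *v u) v"
  by (simp add: ocp_feasible_Suc)

text \<open>
  Dynamic programming reduces the dependence of a whole feasible input sequence on the parameter to
  a single step. The pairs that admit \<open>N + 1\<close> feasible inputs are the projection of a polyhedron in
  the variables \<open>((x, v), u)\<close>, where \<open>u\<close> is the first input; its Lipschitz sections provide that
  input, and the induction hypothesis provides the remaining ones.
\<close>
lemma feasible_inputs_lipschitz:
  fixes T :: "((real^'nx) \<times> (real^'nv)) set" and Y :: "(real^'ny) set" and B :: "real^'nu^'nx"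
  assumes Y: "polyhedron Y" and T: "polyhedron T"
  shows "polyhedron (ocp_domain A B C D Y N T) \<and> (\<exists>L\<ge>0. \<forall>x v x' v' \<mu>.
    \<mu> \<in> ocp_feasible A B C D Y N T x v \<and> (x', v') \<in> ocp_domain A B C D Y N T \<longrightarrow>
    (\<exists>\<mu>'\<in>ocp_feasible A B C D Y N T x' v'. \<forall>i<N. norm (\<mu>' i - \<mu> i) \<le> L * norm ((x', v') - (x, v))))"
proof (induction N)
  case 0
  have feas: "ocp_feasible A B C D Y 0 T x v = (if (x, v) \<in> T then {\<lambda>_. undefined} else {})" for x v
    by (auto simp: ocp_feasible_def)
  then have "ocp_domain A B C D Y 0 T = T" by (auto simp: ocp_domain_def)
  with T show ?case by (simp add: feas) (intro exI[of _ 0] order_refl)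
next
  case (Suc N)
  let ?dom = "\<lambda>N. ocp_domain A B C D Y N T" and ?feas = "\<lambda>N. ocp_feasible A B C D Y N T"
  have IH: "polyhedron (?dom N)" using Suc by blast
  obtain L2 where L2: "L2 \<ge> 0" "\<And>x v x' v' \<mu>. \<mu> \<in> ?feas N x v \<Longrightarrow> (x', v') \<in> ?dom N \<Longrightarrow>
    \<exists>\<mu>'\<in>?feas N x' v'. \<forall>i<N. norm (\<mu>' i - \<mu> i) \<le> L2 * norm ((x', v') - (x, v))"
    using Suc by blast
  define f where "f p = C *v fst (fst p) + D *v snd p" for p :: "((real^'nx) \<times> (real^'nv)) \<times> (real^'nu)"
  define g where "g p = (A *v fst (fst p) + B *v snd p, snd (fst p))"
    for p :: "((real^'nx) \<times> (real^'nv)) \<times> (real^'nu)"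
  have lin: "linear f" "linear g"
    by (auto intro!: linearI simp: f_def g_def matrix_vector_right_distrib matrix_vector_mult_scaleR
        scaleR_add_right algebra_simps)
  define S where "S = f -` Y \<inter> g -` ?dom N"
  have S: "polyhedron S"
    unfolding S_def by (intro polyhedron_Int polyhedron_linear_vimage lin Y IH)
  have memS: "((x, v), u) \<in> S \<longleftrightarrow> C *v x + D *v u \<in> Y \<and> (A *v x + B *v u, v) \<in> ?dom N" for x v u
    by (simp add: S_def f_def g_def)
  have dom_Suc: "?dom (Suc N) = fst ` S"
  proof (rule set_eqI)
    fix p :: "(real^'nx) \<times> (real^'nv)"
    obtain x v where p: "p = (x, v)" by (cases p)
    have "p \<in> ?dom (Suc N) \<longleftrightarrow> (\<exists>\<mu>. \<mu> \<in> ?feas (Suc N) x v)" by (auto simp: p ocp_domain_def)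
    also have "\<dots> \<longleftrightarrow> (\<exists>u \<mu>. case_nat u \<mu> \<in> ?feas (Suc N) x v)"
      by (metis ocp_feasible_Suc ocp_feasible_case_nat)
    also have "\<dots> \<longleftrightarrow> (\<exists>u. ((x, v), u) \<in> S)"
      unfolding ocp_feasible_case_nat memS by (auto simp: ocp_domain_def)
    also have "\<dots> \<longleftrightarrow> p \<in> fst ` S" unfolding p by force
    finally show "p \<in> ?dom (Suc N) \<longleftrightarrow> p \<in> fst ` S" .
  qed
  obtain L1 where L1: "L1 \<ge> 0" "\<And>p u p'. (p, u) \<in> S \<Longrightarrow> p' \<in> fst ` S \<Longrightarrow>
      \<exists>u'. (p', u') \<in> S \<and> norm (u' - u) \<le> L1 * norm (p' - p)"
    using polyhedron_section_lipschitz[OF S] by blast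
  obtain a where a: "a \<ge> 1" "\<And>x. norm (A *v x) \<le> a * norm x"
    using matrix_vector_norm_bound[of A] by blast
  obtain b where b: "b \<ge> 1" "\<And>x. norm (B *v x) \<le> b * norm x"
    using matrix_vector_norm_bound[of B] by blast
  \<comment> \<open>the first input moves by \<open>L1\<close>, hence the successor state by \<open>a + b * L1\<close>\<close>
  define L where "L = L1 + L2 * (a + b * L1 + 1)"
  have L: "L \<ge> 0" "L1 \<le> L" "L2 * (a + b * L1 + 1) \<le> L"
    using L1(1) L2(1) a(1) b(1) by (auto simp: L_def)
  have "\<exists>\<mu>'\<in>?feas (Suc N) x' v'. \<forall>i<Suc N. norm (\<mu>' i - \<mu> i) \<le> L * norm ((x', v') - (x, v))"
    if \<mu>: "\<mu> \<in> ?feas (Suc N) x v" and dom: "(x', v') \<in> ?dom (Suc N)" for x v x' v' \<mu>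
  proof -
    define h where "h = norm ((x', v') - (x, v))"
    have h: "h \<ge> 0" by (simp add: h_def)
    have nx: "norm (x' - x) \<le> h" using norm_fst_le[of "x' - x" "v' - v"] by (simp add: h_def)
    have \<mu>1: "(\<lambda>i. \<mu> (Suc i)) \<in> ?feas N (A *v x + B *v \<mu> 0) v" and "((x, v), \<mu> 0) \<in> S"
      using \<mu> unfolding ocp_feasible_Suc memS by (auto simp: ocp_domain_def)
    then obtain u' where u': "((x', v'), u') \<in> S" "norm (u' - \<mu> 0) \<le> L1 * h"
      using L1(2) dom unfolding dom_Suc h_def by blast
    then have "(A *v x' + B *v u', v') \<in> ?dom N" by (simp add: memS)
    then obtain \<mu>' where \<mu>': "\<mu>' \<in> ?feas N (A *v x' + B *v u') v'"
      "\<And>i. i < N \<Longrightarrow> norm (\<mu>' i - \<mu> (Suc i)) \<le> L2 * norm ((A *v x' + B *v u', v') - (A *v x + B *v \<mu> 0, v))"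
      using L2(2)[OF \<mu>1] by blast
    have "norm ((A *v x' + B *v u', v') - (A *v x + B *v \<mu> 0, v))
        \<le> norm (A *v (x' - x) + B *v (u' - \<mu> 0)) + norm (v' - v)"
      using norm_Pair_le[of "A *v (x' - x) + B *v (u' - \<mu> 0)" "v' - v"]
      by (simp add: matrix_vector_mult_diff_distrib algebra_simps)
    also have "\<dots> \<le> a * h + b * (L1 * h) + h"
    proof (intro add_mono order_trans[OF norm_triangle_ineq])
      show "norm (A *v (x' - x)) \<le> a * h"
        using a(2)[of "x' - x"] mult_left_mono[OF nx, of a] a(1) by linarith
      show "norm (B *v (u' - \<mu> 0)) \<le> b * (L1 * h)"
        using b(2)[of "u' - \<mu> 0"] mult_left_mono[OF u'(2), of b] b(1) by linarith
      show "norm (v' - v) \<le> h"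
        using norm_snd_le[of "v' - v" "x' - x"] by (simp add: h_def)
    qed
    finally have "L2 * norm ((A *v x' + B *v u', v') - (A *v x + B *v \<mu> 0, v)) \<le> L2 * ((a + b * L1 + 1) * h)"
      by (intro mult_left_mono L2(1)) (simp add: algebra_simps)
    also have "\<dots> \<le> L * h" using mult_right_mono[OF L(3) h] by (simp add: mult.assoc)
    finally have "norm (\<mu>' i - \<mu> (Suc i)) \<le> L * h" if "i < N" for i
      using \<mu>'(2)[OF that] by linarith
    moreover have "norm (u' - \<mu> 0) \<le> L * h" using u'(2) mult_right_mono[OF L(2) h] by linarith
    ultimately have "\<forall>i<Suc N. norm (case_nat u' \<mu>' i - \<mu> i) \<le> L * h"
      by (auto simp: All_less_Suc2)
    moreover have "case_nat u' \<mu>' \<in> ?feas (Suc N) x' v'"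
      unfolding ocp_feasible_case_nat using \<mu>'(1) u'(1) memS by blast
    ultimately show ?thesis unfolding h_def by blast
  qed
  moreover have "polyhedron (?dom (Suc N))" unfolding dom_Suc by (rule polyhedron_fst_image[OF S])
  ultimately show ?case using L(1) by blast
qed

lemma traj_deviation:
  fixes A :: "real^'nx^'nx" and B :: "real^'nu^'nx"
  obtains M where "M \<ge> 1" "\<And>x x' \<mu> \<mu>' h i. i \<le> N \<Longrightarrow> norm (x' - x) \<le> h \<Longrightarrow>
    (\<And>j. j < N \<Longrightarrow> norm (\<mu>' j - \<mu> j) \<le> h) \<Longrightarrow> norm (traj A B x' \<mu>' i - traj A B x \<mu> i) \<le> M * h"
proof -
  obtain a where a: "a \<ge> 1" "\<And>x. norm (A *v x) \<le> a * norm x"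
    using matrix_vector_norm_bound[of A] by blast
  obtain b where b: "b \<ge> 1" "\<And>x. norm (B *v x) \<le> b * norm x"
    using matrix_vector_norm_bound[of B] by blast
  have ab: "1 \<le> a + b" using a(1) b(1) by linarith
  have "norm (traj A B x' \<mu>' i - traj A B x \<mu> i) \<le> (a + b) ^ N * h"
    if i: "i \<le> N" and x: "norm (x' - x) \<le> h" and \<mu>: "\<And>j. j < N \<Longrightarrow> norm (\<mu>' j - \<mu> j) \<le> h"
    for x x' \<mu> \<mu>' h i
  proof -
    have h: "h \<ge> 0" using x norm_ge_zero order_trans by blast
    have "norm (traj A B x' \<mu>' i - traj A B x \<mu> i) \<le> (a + b) ^ i * h"
      using i
    proof (induction i)
      case (Suc i)
      define d where "d = traj A B x' \<mu>' i - traj A B x \<mu> i"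
      have d: "norm d \<le> (a + b) ^ i * h" using Suc by (simp add: d_def)
      have "1 \<le> (a + b) ^ i" using ab by (rule one_le_power)
      then have hd: "h \<le> (a + b) ^ i * h" using mult_right_mono[of 1 "(a + b) ^ i" h] h by simp
      have "traj A B x' \<mu>' (Suc i) - traj A B x \<mu> (Suc i) = A *v d + B *v (\<mu>' i - \<mu> i)"
        by (simp add: d_def matrix_vector_mult_diff_distrib)
      then have "norm (traj A B x' \<mu>' (Suc i) - traj A B x \<mu> (Suc i)) \<le> norm (A *v d) + norm (B *v (\<mu>' i - \<mu> i))"
        by (simp only: norm_triangle_ineq)
      also have "\<dots> \<le> a * ((a + b) ^ i * h) + b * ((a + b) ^ i * h)"
      proof (rule add_mono)
        show "norm (A *v d) \<le> a * ((a + b) ^ i * h)"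
          using a(2)[of d] mult_left_mono[OF d, of a] a(1) by linarith
        have "norm (\<mu>' i - \<mu> i) \<le> (a + b) ^ i * h" using \<mu>[of i] Suc.prems hd by linarith
        then show "norm (B *v (\<mu>' i - \<mu> i)) \<le> b * ((a + b) ^ i * h)"
          using b(2)[of "\<mu>' i - \<mu> i"] mult_left_mono[of _ _ b] b(1) by (smt (verit))
      qed
      also have "\<dots> = (a + b) ^ Suc i * h" by (simp only: power_Suc distrib_right mult.assoc)
      finally show ?case .
    qed (use x in simp)
    also have "\<dots> \<le> (a + b) ^ N * h"
      using i ab h by (intro mult_right_mono power_increasing)
    finally show ?thesis .
  qed
  moreover have "1 \<le> (a + b) ^ N" using ab by (rule one_le_power)
  ultimately show ?thesis using that by blast
qed

text \<open>
  The cost is a sum of semidefinite forms of deviations that depend linearly on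
  \<open>(x, v, \<mu>)\<close>, so the Young inequality applies to each of them.
\<close>
lemma ocp_cost_perturbation:
  fixes G :: "real^'nv^('nx::finite + 'nu::finite + 'nz::finite)"
  assumes Q: "symmetric_mat Q" "pos_semidef Q" and R: "symmetric_mat R" "pos_semidef R"
    and P: "symmetric_mat P" "pos_semidef P"
  obtains c where "c \<ge> 0" "\<And>x v \<mu> x' v' \<mu>' h \<theta>. \<theta> > 0 \<Longrightarrow> norm (x' - x) \<le> h \<Longrightarrow> norm (v' - v) \<le> h \<Longrightarrow>
      (\<And>j. j < N \<Longrightarrow> norm (\<mu>' j - \<mu> j) \<le> h) \<Longrightarrow>
      ocp_cost A B G N P Q R x' v' \<mu>' \<le> (1 + \<theta>) * ocp_cost A B G N P Q R x v \<mu> + (1 + 1/\<theta>) * (c * h\<^sup>2)"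
proof -
  obtain M where M: "M \<ge> 1" "\<And>x x' \<mu> \<mu>' h i. i \<le> N \<Longrightarrow> norm (x' - x) \<le> h \<Longrightarrow>
      (\<And>j. j < N \<Longrightarrow> norm (\<mu>' j - \<mu> j) \<le> h) \<Longrightarrow> norm (traj A B x' \<mu>' i - traj A B x \<mu> i) \<le> M * h"
    using traj_deviation[of N A B] by blast
  obtain gx where gx: "gx \<ge> 1" "\<And>v. norm (Gx G *v v) \<le> gx * norm v"
    using matrix_vector_norm_bound[of "Gx G"] by blast
  obtain gu where gu: "gu \<ge> 1" "\<And>v. norm (Gu G *v v) \<le> gu * norm v"
    using matrix_vector_norm_bound[of "Gu G"] by blast
  obtain p where p: "p \<ge> 1" "\<And>x. (wnorm P x)\<^sup>2 \<le> p * (norm x)\<^sup>2"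
    using wnorm_squared_le_norm[OF P(2)] by blast
  obtain q where q: "q \<ge> 1" "\<And>x. (wnorm Q x)\<^sup>2 \<le> q * (norm x)\<^sup>2"
    using wnorm_squared_le_norm[OF Q(2)] by blast
  obtain r where r: "r \<ge> 1" "\<And>x. (wnorm R x)\<^sup>2 \<le> r * (norm x)\<^sup>2"
    using wnorm_squared_le_norm[OF R(2)] by blast
  define cp where "cp = p * (M + gx)\<^sup>2"
  define cq where "cq = q * (M + gx)\<^sup>2"
  define cr where "cr = r * (1 + gu)\<^sup>2"
  define c where "c = cp + real N * (cq + cr)"
  have "c \<ge> 0" using p(1) q(1) r(1) by (simp add: c_def cp_def cq_def cr_def)
  moreover have "ocp_cost A B G N P Q R x' v' \<mu>' \<le> (1 + \<theta>) * ocp_cost A B G N P Q R x v \<mu> + (1 + 1/\<theta>) * (c * h\<^sup>2)"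
    if \<theta>: "\<theta> > 0" and x: "norm (x' - x) \<le> h" and v: "norm (v' - v) \<le> h"
      and \<mu>: "\<And>j. j < N \<Longrightarrow> norm (\<mu>' j - \<mu> j) \<le> h" for x v \<mu> x' v' \<mu>' h \<theta>
  proof -
    have h: "h \<ge> 0" using x norm_ge_zero order_trans by blast
    have weighted: "(wnorm W y')\<^sup>2 \<le> (1 + \<theta>) * (wnorm W y)\<^sup>2 + (1 + 1/\<theta>) * (w * k\<^sup>2 * h\<^sup>2)"
      if W: "symmetric_mat W" "pos_semidef W" "\<And>x. (wnorm W x)\<^sup>2 \<le> w * (norm x)\<^sup>2" "w \<ge> 1"
        and d: "norm (y' - y) \<le> k * h" for W :: "real^'k^'k" and y' y w k
    proof -
      have "(norm (y' - y))\<^sup>2 \<le> k\<^sup>2 * h\<^sup>2" using power_mono[OF d, of 2] by (simp add: power_mult_distrib)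
      then have "(wnorm W (y' - y))\<^sup>2 \<le> w * k\<^sup>2 * h\<^sup>2"
        using W(3)[of "y' - y"] mult_left_mono[of _ _ w] W(4) by (smt (verit) mult.assoc)
      then have "(1 + 1/\<theta>) * (wnorm W (y' - y))\<^sup>2 \<le> (1 + 1/\<theta>) * (w * k\<^sup>2 * h\<^sup>2)"
        using \<theta> by (intro mult_left_mono) auto
      then show ?thesis
        using wnorm_squared_add_le[OF W(1,2) \<theta>, of y "y' - y"] by simp
    qed
    have state: "norm ((traj A B x' \<mu>' i - xbar G v') - (traj A B x \<mu> i - xbar G v)) \<le> (M + gx) * h"
      if "i \<le> N" for i
    proof -
      have eq: "(traj A B x' \<mu>' i - xbar G v') - (traj A B x \<mu> i - xbar G v)
          = (traj A B x' \<mu>' i - traj A B x \<mu> i) - Gx G *v (v' - v)"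
        by (simp add: xbar_def matrix_vector_mult_diff_distrib)
      have "norm (traj A B x' \<mu>' i - traj A B x \<mu> i) \<le> M * h" by (rule M(2)[OF that x \<mu>])
      moreover have "norm (Gx G *v (v' - v)) \<le> gx * h"
        using gx(2)[of "v' - v"] mult_left_mono[OF v, of gx] gx(1) by linarith
      ultimately show ?thesis
        using norm_triangle_ineq4[of "traj A B x' \<mu>' i - traj A B x \<mu> i" "Gx G *v (v' - v)"]
        unfolding eq distrib_right by linarith
    qed
    have input: "norm ((\<mu>' i - ubar G v') - (\<mu> i - ubar G v)) \<le> (1 + gu) * h" if "i < N" for i
    proof -
      have eq: "(\<mu>' i - ubar G v') - (\<mu> i - ubar G v) = (\<mu>' i - \<mu> i) - Gu G *v (v' - v)"
        by (simp add: ubar_def matrix_vector_mult_diff_distrib)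
      have "norm (Gu G *v (v' - v)) \<le> gu * h"
        using gu(2)[of "v' - v"] mult_left_mono[OF v, of gu] gu(1) by linarith
      then show ?thesis
        using norm_triangle_ineq4[of "\<mu>' i - \<mu> i" "Gu G *v (v' - v)"] \<mu>[OF that]
        unfolding eq distrib_right by linarith
    qed
    let ?x = "\<lambda>i. traj A B x \<mu> i - xbar G v" and ?u = "\<lambda>i. \<mu> i - ubar G v"
    let ?x' = "\<lambda>i. traj A B x' \<mu>' i - xbar G v'" and ?u' = "\<lambda>i. \<mu>' i - ubar G v'"
    have tP: "(wnorm P (?x' N))\<^sup>2 \<le> (1 + \<theta>) * (wnorm P (?x N))\<^sup>2 + (1 + 1/\<theta>) * (cp * h\<^sup>2)"
      unfolding cp_def by (rule weighted[OF P p(2) p(1) state]) simp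
    have tQR: "(wnorm Q (?x' i))\<^sup>2 + (wnorm R (?u' i))\<^sup>2
        \<le> (1 + \<theta>) * ((wnorm Q (?x i))\<^sup>2 + (wnorm R (?u i))\<^sup>2) + (1 + 1/\<theta>) * ((cq + cr) * h\<^sup>2)" if "i < N" for i
    proof -
      have "(wnorm Q (?x' i))\<^sup>2 \<le> (1 + \<theta>) * (wnorm Q (?x i))\<^sup>2 + (1 + 1/\<theta>) * (cq * h\<^sup>2)"
        unfolding cq_def using that by (intro weighted[OF Q q(2) q(1) state]) simp
      moreover have "(wnorm R (?u' i))\<^sup>2 \<le> (1 + \<theta>) * (wnorm R (?u i))\<^sup>2 + (1 + 1/\<theta>) * (cr * h\<^sup>2)"
        unfolding cr_def by (rule weighted[OF R r(2) r(1) input[OF that]])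
      ultimately show ?thesis unfolding distrib_left distrib_right by linarith
    qed
    have "(\<Sum>i<N. (wnorm Q (?x' i))\<^sup>2 + (wnorm R (?u' i))\<^sup>2)
        \<le> (\<Sum>i<N. (1 + \<theta>) * ((wnorm Q (?x i))\<^sup>2 + (wnorm R (?u i))\<^sup>2) + (1 + 1/\<theta>) * ((cq + cr) * h\<^sup>2))"
      by (intro sum_mono tQR) simp
    also have "\<dots> = (1 + \<theta>) * (\<Sum>i<N. (wnorm Q (?x i))\<^sup>2 + (wnorm R (?u i))\<^sup>2)
        + (1 + 1/\<theta>) * (real N * (cq + cr) * h\<^sup>2)"
      by (subst sum.distrib) (simp add: sum_distrib_left mult_ac)
    finally have sums: "(\<Sum>i<N. (wnorm Q (?x' i))\<^sup>2 + (wnorm R (?u' i))\<^sup>2)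
        \<le> (1 + \<theta>) * (\<Sum>i<N. (wnorm Q (?x i))\<^sup>2 + (wnorm R (?u i))\<^sup>2) + (1 + 1/\<theta>) * (real N * (cq + cr) * h\<^sup>2)" .
    have "(1 + 1/\<theta>) * (c * h\<^sup>2) = (1 + 1/\<theta>) * (cp * h\<^sup>2) + (1 + 1/\<theta>) * (real N * (cq + cr) * h\<^sup>2)"
      by (simp only: c_def distrib_right distrib_left)
    moreover have "(1 + \<theta>) * ocp_cost A B G N P Q R x v \<mu> = (1 + \<theta>) * (wnorm P (?x N))\<^sup>2
        + (1 + \<theta>) * (\<Sum>i<N. (wnorm Q (?x i))\<^sup>2 + (wnorm R (?u i))\<^sup>2)"
      by (simp only: ocp_cost_def distrib_left)
    moreover have "ocp_cost A B G N P Q R x' v' \<mu>' = (wnorm P (?x' N))\<^sup>2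
        + (\<Sum>i<N. (wnorm Q (?x' i))\<^sup>2 + (wnorm R (?u' i))\<^sup>2)"
      by (simp only: ocp_cost_def)
    ultimately show ?thesis using tP sums by linarith
  qed
  ultimately show ?thesis using that by blast
qed

section \<open>Terminal controller and descent of the optimal cost\<close>

lemma wnorm_gain_squared:
  assumes "pos_semidef Q" "pos_semidef R"
  shows "(wnorm (Q + transpose K ** R ** K) x)\<^sup>2 = (wnorm Q x)\<^sup>2 + (wnorm R (K *v x))\<^sup>2"
proof -
  have "x \<bullet> ((transpose K ** R ** K) *v x) = (K *v x) \<bullet> (R *v (K *v x))"
    by (metis dot_lmul_matrix matrix_vector_mul_assoc transpose_matrix_vector inner_commute)
  then have "x \<bullet> ((Q + transpose K ** R ** K) *v x) = (wnorm Q x)\<^sup>2 + (wnorm R (K *v x))\<^sup>2"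
    by (simp add: matrix_vector_mult_add_rdistrib inner_add_right wnorm_squared assms)
  moreover have "0 \<le> (wnorm Q x)\<^sup>2 + (wnorm R (K *v x))\<^sup>2" by simp
  ultimately show ?thesis by (simp add: wnorm_def)
qed

text \<open>
  The standard Lyapunov argument of predictive control: drop the input that has been applied and
  append the terminal control law. The terminal cost inequality pays for the additional stage.
\<close>
lemma ocp_cost_shift:
  assumes QR: "pos_semidef Q" "pos_semidef R"
    and T_cost: "\<And>x v. (x, v) \<in> T \<Longrightarrow>
        (wnorm P ((A - B ** K) *v (x - xbar G v)))\<^sup>2 - (wnorm P (x - xbar G v))\<^sup>2
          \<le> - (wnorm (Q + transpose K ** R ** K) (x - xbar G v))\<^sup>2"
    and T_inv: "\<And>x v. (x, v) \<in> T \<Longrightarrow> (A *v x + B *v terminal_law G K x v, v) \<in> T"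
    and T_con: "\<And>x v. (x, v) \<in> T \<Longrightarrow> C *v x + D *v terminal_law G K x v \<in> Y"
    and eq: "\<And>v. A *v xbar G v + B *v ubar G v = xbar G v"
    and N: "1 \<le> N" and \<mu>: "\<mu> \<in> ocp_feasible A B C D Y N T x v"
  obtains \<mu>' where "\<mu>' \<in> ocp_feasible A B C D Y N T (A *v x + B *v \<mu> 0) v"
    "ocp_cost A B G N P Q R (A *v x + B *v \<mu> 0) v \<mu>'
      \<le> ocp_cost A B G N P Q R x v \<mu> - ((wnorm Q (x - xbar G v))\<^sup>2 + (wnorm R (\<mu> 0 - ubar G v))\<^sup>2)"
proof -
  obtain n where n: "N = Suc n" using N by (cases N) auto
  define \<xi> where "\<xi> i = traj A B x \<mu> i" for i
  define \<kappa> where "\<kappa> = terminal_law G K (\<xi> N) v"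
  define \<mu>' where "\<mu>' i = (if i < n then \<mu> (Suc i) else if i = n then \<kappa> else undefined)" for i
  let ?x = "A *v x + B *v \<mu> 0"
  have T: "(\<xi> N, v) \<in> T" and Y: "\<And>i. i < N \<Longrightarrow> C *v \<xi> i + D *v \<mu> i \<in> Y"
    using \<mu> by (auto simp: ocp_feasible_def \<xi>_def)
  have tr: "traj A B ?x \<mu>' i = \<xi> (Suc i)" if "i \<le> n" for i
  proof -
    have "traj A B ?x \<mu>' i = traj A B ?x (\<lambda>i. \<mu> (Suc i)) i"
      using that by (intro traj_cong) (simp add: \<mu>'_def)
    then show ?thesis unfolding \<xi>_def traj_shift .
  qed
  have trN: "traj A B ?x \<mu>' N = A *v \<xi> N + B *v \<kappa>"
    using tr[of n] by (simp add: n \<mu>'_def)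
  have "\<mu>' \<in> ocp_feasible A B C D Y N T ?x v"
    unfolding ocp_feasible_def
  proof (intro CollectI conjI allI impI)
    show "\<mu>' \<in> {..<N} \<rightarrow>\<^sub>E UNIV" by (auto simp: n \<mu>'_def PiE_iff extensional_def)
    show "(traj A B ?x \<mu>' N, v) \<in> T" unfolding trN \<kappa>_def by (rule T_inv[OF T])
    fix i assume "i < N"
    then consider "i < n" | "i = n" by (auto simp: n less_Suc_eq)
    then show "C *v traj A B ?x \<mu>' i + D *v \<mu>' i \<in> Y"
    proof cases
      case 1
      then show ?thesis using tr[of i] Y[of "Suc i"] by (simp add: \<mu>'_def n)
    next
      case 2
      then show ?thesis using tr[of i] T_con[OF T] by (simp add: \<mu>'_def n \<kappa>_def)
    qed
  qed
  moreover have "ocp_cost A B G N P Q R ?x v \<mu>'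
      \<le> ocp_cost A B G N P Q R x v \<mu> - ((wnorm Q (x - xbar G v))\<^sup>2 + (wnorm R (\<mu> 0 - ubar G v))\<^sup>2)"
  proof -
    define \<delta> where "\<delta> = \<xi> N - xbar G v"
    define l where "l i = (wnorm Q (\<xi> i - xbar G v))\<^sup>2 + (wnorm R (\<mu> i - ubar G v))\<^sup>2" for i
    define l' where "l' i = (wnorm Q (traj A B ?x \<mu>' i - xbar G v))\<^sup>2 + (wnorm R (\<mu>' i - ubar G v))\<^sup>2" for i
    have "A *v \<xi> N + B *v \<kappa> - xbar G v
        = A *v \<xi> N + B *v \<kappa> - (A *v xbar G v + B *v ubar G v)" by (simp only: eq)
    also have "\<dots> = (A - B ** K) *v \<delta>"
      by (simp add: \<kappa>_def \<delta>_def terminal_law_def matrix_vector_mult_diff_distrib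
          matrix_vector_mult_diff_rdistrib matrix_vector_mul_assoc[symmetric])
    finally have final: "traj A B ?x \<mu>' N - xbar G v = (A - B ** K) *v \<delta>" unfolding trN .
    have "\<kappa> - ubar G v = - (K *v \<delta>)" by (simp add: \<kappa>_def \<delta>_def terminal_law_def)
    then have "(wnorm R (\<kappa> - ubar G v))\<^sup>2 = (wnorm R (K *v \<delta>))\<^sup>2"
      by (simp add: wnorm_def linear_neg[OF matrix_vector_mul_linear])
    then have "l' n = (wnorm (Q + transpose K ** R ** K) \<delta>)\<^sup>2"
      using tr[of n] by (simp add: l'_def \<delta>_def n \<mu>'_def wnorm_gain_squared[OF QR])
    moreover have "(wnorm P ((A - B ** K) *v \<delta>))\<^sup>2 - (wnorm P \<delta>)\<^sup>2
        \<le> - (wnorm (Q + transpose K ** R ** K) \<delta>)\<^sup>2"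
      unfolding \<delta>_def by (rule T_cost[OF T])
    ultimately have P: "(wnorm P ((A - B ** K) *v \<delta>))\<^sup>2 + l' n \<le> (wnorm P \<delta>)\<^sup>2" by linarith
    have "l' i = l (Suc i)" if "i < n" for i
      using tr[of i] that by (simp add: l'_def l_def \<mu>'_def)
    then have "(\<Sum>i<N. l' i) = (\<Sum>i<n. l (Suc i)) + l' n" by (simp add: n)
    moreover have "(\<Sum>i<N. l i) = l 0 + (\<Sum>i<n. l (Suc i))"
      unfolding n by (rule sum.lessThan_Suc_shift)
    moreover have "l 0 = (wnorm Q (x - xbar G v))\<^sup>2 + (wnorm R (\<mu> 0 - ubar G v))\<^sup>2"
      by (simp add: l_def \<xi>_def)
    moreover have "ocp_cost A B G N P Q R x v \<mu> = (wnorm P \<delta>)\<^sup>2 + (\<Sum>i<N. l i)"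
      by (simp add: ocp_cost_def \<delta>_def l_def \<xi>_def)
    moreover have "ocp_cost A B G N P Q R ?x v \<mu>' = (wnorm P ((A - B ** K) *v \<delta>))\<^sup>2 + (\<Sum>i<N. l' i)"
      by (simp only: ocp_cost_def final l'_def)
    ultimately show ?thesis using P by linarith
  qed
  ultimately show ?thesis using that by blast
qed

text \<open>
  The stage cost dominates the output and the disturbance terms that occur in the observability
  estimate.
\<close>
lemma weighted_squares_bound:
  fixes B :: "real^'nu^'nx"
  assumes Q: "symmetric_mat Q" "pos_semidef Q" and R: "pos_def R"
  obtains c where "c \<ge> 1"
    "\<And>y w. (norm (Q *v y))\<^sup>2 + (norm (B *v w))\<^sup>2 \<le> c * ((wnorm Q y)\<^sup>2 + (wnorm R w)\<^sup>2)"
proof -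
  obtain q where q: "q \<ge> 1" "\<And>x. (norm (Q *v x))\<^sup>2 \<le> q * (wnorm Q x)\<^sup>2"
    using norm_mult_squared_le_wnorm[OF Q] by blast
  obtain r where r: "r \<ge> 1" "\<And>x. (norm x)\<^sup>2 \<le> r * (wnorm R x)\<^sup>2"
    using norm_squared_le_wnorm[OF R] by blast
  obtain b where b: "b \<ge> 1" "\<And>x. norm (B *v x) \<le> b * norm x"
    using matrix_vector_norm_bound[of B] by blast
  have "(norm (Q *v y))\<^sup>2 + (norm (B *v w))\<^sup>2 \<le> (q + b\<^sup>2 * r) * ((wnorm Q y)\<^sup>2 + (wnorm R w)\<^sup>2)" for y w
  proof -
    have "(norm (B *v w))\<^sup>2 \<le> b\<^sup>2 * (norm w)\<^sup>2"
      using power_mono[OF b(2)[of w], of 2] by (simp add: power_mult_distrib)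
    also have "\<dots> \<le> b\<^sup>2 * (r * (wnorm R w)\<^sup>2)" using r(2) by (intro mult_left_mono) auto
    finally have B: "(norm (B *v w))\<^sup>2 \<le> b\<^sup>2 * r * (wnorm R w)\<^sup>2" by (simp add: mult.assoc)
    have "0 \<le> q * (wnorm R w)\<^sup>2" "0 \<le> b\<^sup>2 * r * (wnorm Q y)\<^sup>2" using q(1) r(1) by auto
    then show ?thesis using q(2)[of y] B unfolding distrib_left distrib_right by linarith
  qed
  moreover have "q + b\<^sup>2 * r \<ge> 1" using q(1) r(1) by (simp add: add_increasing2)
  ultimately show ?thesis using that by blast
qed

text \<open>
  Under the terminal controller the terminal cost decreases at least by the stage cost, so the stage costs
  are summable and tend to zero. Observability turns this into convergence of the state to the steady
  state, and the terminal set is closed.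
\<close>
lemma terminal_set_contains_steady_state:
  fixes B :: "real^'nu^'nx" and T :: "((real^'nx) \<times> (real^'nv)) set"
  assumes Q: "symmetric_mat Q" "pos_semidef Q" "observable A Q" and R: "pos_def R"
    and T: "closed T"
    and T_cost: "\<And>x v. (x, v) \<in> T \<Longrightarrow>
        (wnorm P ((A - B ** K) *v (x - xbar G v)))\<^sup>2 - (wnorm P (x - xbar G v))\<^sup>2
          \<le> - (wnorm (Q + transpose K ** R ** K) (x - xbar G v))\<^sup>2"
    and T_inv: "\<And>x v. (x, v) \<in> T \<Longrightarrow> (A *v x + B *v terminal_law G K x v, v) \<in> T"
    and eq: "\<And>v. A *v xbar G v + B *v ubar G v = xbar G v"
    and x: "(x, v) \<in> T"
  shows "(xbar G v, v) \<in> T"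
proof -
  define z where "z = rec_nat x (\<lambda>_ z. A *v z + B *v terminal_law G K z v)"
  have z: "z 0 = x" "z (Suc i) = A *v z i + B *v terminal_law G K (z i) v" for i
    by (simp_all add: z_def)
  have zT: "(z i, v) \<in> T" for i
    by (induction i) (use x T_inv z in auto)
  define \<delta> where "\<delta> i = z i - xbar G v" for i
  have step: "\<delta> (Suc i) = A *v \<delta> i + B *v (- (K *v \<delta> i))" for i
  proof -
    have "\<delta> (Suc i) = A *v z i + B *v terminal_law G K (z i) v - (A *v xbar G v + B *v ubar G v)"
      by (simp only: \<delta>_def z eq)
    also have "\<dots> = A *v \<delta> i + B *v (- (K *v \<delta> i))"
      unfolding \<delta>_def terminal_law_def
      by (simp add: matrix_vector_mult_diff_distrib linear_neg[OF matrix_vector_mul_linear])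
    finally show ?thesis .
  qed
  have closed_step: "\<delta> (Suc i) = (A - B ** K) *v \<delta> i" for i
    unfolding step
    by (simp add: matrix_vector_mult_diff_rdistrib matrix_vector_mul_assoc[symmetric]
        linear_neg[OF matrix_vector_mul_linear])
  have psd: "pos_semidef R" using R by (rule pos_def_imp_pos_semidef)
  define s where "s i = (wnorm Q (\<delta> i))\<^sup>2 + (wnorm R (- (K *v \<delta> i)))\<^sup>2" for i
  have s_eq: "s i = (wnorm (Q + transpose K ** R ** K) (\<delta> i))\<^sup>2" for i
    by (simp add: s_def wnorm_gain_squared[OF Q(2) psd])
      (simp add: wnorm_def linear_neg[OF matrix_vector_mul_linear])
  have dec: "(wnorm P (\<delta> (Suc i)))\<^sup>2 + s i \<le> (wnorm P (\<delta> i))\<^sup>2" for i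
    using T_cost[OF zT[of i]] unfolding closed_step s_eq \<delta>_def[symmetric] by linarith
  have total: "(wnorm P (\<delta> n))\<^sup>2 + (\<Sum>i<n. s i) \<le> (wnorm P (\<delta> 0))\<^sup>2" for n
  proof (induction n)
    case (Suc n)
    then show ?case using dec[of n] by simp
  qed simp
  have s0: "s i \<ge> 0" for i by (simp add: s_def)
  have "(\<Sum>i<n. s i) \<le> (wnorm P (\<delta> 0))\<^sup>2" for n
    using total[of n] zero_le_power2[of "wnorm P (\<delta> n)"] by linarith
  then have "summable s" by (intro summableI_nonneg_bounded s0)
  then have s_lim: "s \<longlonglongrightarrow> 0" by (rule summable_LIMSEQ_zero)
  obtain m c where c: "c \<ge> 1" "\<And>\<delta> e. (\<And>i. \<delta> (Suc i) = A *v \<delta> i + e i) \<Longrightarrow>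
      (norm (\<delta> 0))\<^sup>2 \<le> c * (\<Sum>i<m. (norm (Q *v \<delta> i))\<^sup>2 + (norm (e i))\<^sup>2)"
    by (rule observable_window_estimate[OF Q(3)]) blast
  obtain b where b: "b \<ge> 1"
    "\<And>y w. (norm (Q *v y))\<^sup>2 + (norm (B *v w))\<^sup>2 \<le> b * ((wnorm Q y)\<^sup>2 + (wnorm R w)\<^sup>2)"
    by (rule weighted_squares_bound[OF Q(1,2) R]) blast
  have bound: "(norm (\<delta> k))\<^sup>2 \<le> c * (\<Sum>i<m. b * s (k + i))" for k
  proof -
    have "(norm (\<delta> (k + 0)))\<^sup>2 \<le> c * (\<Sum>i<m. (norm (Q *v \<delta> (k + i)))\<^sup>2 + (norm (B *v (- (K *v \<delta> (k + i)))))\<^sup>2)"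
      by (rule c(2)[of "\<lambda>i. \<delta> (k + i)"]) (simp only: add_Suc_right step)
    also have "\<dots> \<le> c * (\<Sum>i<m. b * s (k + i))"
      unfolding s_def using c(1) by (intro mult_left_mono sum_mono b(2)) simp
    finally show ?thesis by simp
  qed
  have "(\<lambda>k. c * (\<Sum>i<m. b * s (k + i))) \<longlonglongrightarrow> c * (\<Sum>i<m. b * 0)"
    by (intro tendsto_mult tendsto_const tendsto_sum LIMSEQ_ignore_initial_segment s_lim)
  then have lim: "(\<lambda>k. c * (\<Sum>i<m. b * s (k + i))) \<longlonglongrightarrow> 0" by simp
  have "(\<lambda>k. (norm (\<delta> k))\<^sup>2) \<longlonglongrightarrow> 0"
    by (rule tendsto_sandwich[OF _ _ tendsto_const lim]) (auto intro!: always_eventually bound)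
  then have "(\<lambda>k. norm (\<delta> k)) \<longlonglongrightarrow> 0"
    using tendsto_real_sqrt[of "\<lambda>k. (norm (\<delta> k))\<^sup>2"] by fastforce
  then have "\<delta> \<longlonglongrightarrow> 0" by (rule tendsto_norm_zero_cancel)
  then have "z \<longlonglongrightarrow> xbar G v" unfolding \<delta>_def using LIM_zero_cancel by blast
  then have "(\<lambda>i. (z i, v)) \<longlonglongrightarrow> (xbar G v, v)" by (intro tendsto_Pair tendsto_const)
  then show ?thesis by (rule closed_sequentially[OF T, rotated]) (rule zT)
qed

section \<open>Existence of minimizers\<close>

lemma continuous_on_matrix_vector_mult:
  fixes M :: "real^'n^'m"
  shows "continuous_on S f \<Longrightarrow> continuous_on S (\<lambda>x. M *v f x)"
  by (rule bounded_linear.continuous_on[OF matrix_vector_mul_bounded_linear])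

lemma continuous_on_coordinate:
  "continuous_on S (\<lambda>\<mu>::'i \<Rightarrow> 'a::topological_space. \<mu> i)"
  by (rule continuous_on_subset[OF continuous_on_product_coordinates]) simp

lemma continuous_on_traj: "continuous_on S (\<lambda>\<mu>. traj A B x \<mu> i)"
proof (induction i)
  case (Suc i)
  then show ?case
    unfolding traj.simps
    by (intro continuous_on_add continuous_on_matrix_vector_mult continuous_on_coordinate)
qed simp

lemma is_arg_min_arg_min_on:
  assumes "is_arg_min f (\<lambda>x. x \<in> S) x"
  shows "is_arg_min f (\<lambda>x. x \<in> S) (arg_min_on f S)"
  using someI[of "is_arg_min f (\<lambda>x. x \<in> S)", OF assms] unfolding arg_min_on_def arg_min_def .

text \<open>
  Since \<open>R\<close> is definite, inputs with a cost not exceeding that of a given feasible sequence are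
  bounded. They form a compact set in the product topology, where extensionality is
  expressed by singleton factors beyond the horizon.
\<close>
lemma ocp_minimizer_exists:
  fixes B :: "real^'nu^'nx" and T :: "((real^'nx) \<times> (real^'nv)) set"
  assumes Y: "closed Y" and T: "closed T" and Q: "pos_semidef Q" and R: "pos_def R"
    and \<mu>0: "\<mu>0 \<in> ocp_feasible A B C D Y N T x v"
  shows "is_arg_min (ocp_cost A B G N P Q R x v) (\<lambda>\<mu>. \<mu> \<in> ocp_feasible A B C D Y N T x v)
    (arg_min_on (ocp_cost A B G N P Q R x v) (ocp_feasible A B C D Y N T x v))"
proof -
  let ?J = "ocp_cost A B G N P Q R x v" and ?S = "ocp_feasible A B C D Y N T x v"
  obtain r where r: "r \<ge> 1" "\<And>x. (norm x)\<^sup>2 \<le> r * (wnorm R x)\<^sup>2"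
    using norm_squared_le_wnorm[OF R] by blast
  define \<rho> where "\<rho> = norm (ubar G v) + sqrt (r * ?J \<mu>0)"
  define E where "E = PiE UNIV (\<lambda>i. if i < N then cball (0::real^'nu) \<rho> else {undefined})"
  have "compactin (product_topology (\<lambda>i. euclidean) UNIV) E"
    unfolding E_def compactin_PiE by auto
  then have E: "compact E" by (simp add: euclidean_product_topology)
  define F where "F = (\<Inter>i\<in>{..<N}. {\<mu>. C *v traj A B x \<mu> i + D *v \<mu> i \<in> Y}) \<inter> {\<mu>. (traj A B x \<mu> N, v) \<in> T}"
  have "closed F"
    unfolding F_def
  proof (intro closed_Int closed_INT ballI)
    fix i
    have "continuous_on UNIV (\<lambda>\<mu>. C *v traj A B x \<mu> i + D *v \<mu> i)"
      by (intro continuous_on_add continuous_on_matrix_vector_mult continuous_on_traj continuous_on_coordinate)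
    then show "closed {\<mu>. C *v traj A B x \<mu> i + D *v \<mu> i \<in> Y}"
      using closed_vimage[OF Y] by (simp add: vimage_def)
  next
    have "continuous_on UNIV (\<lambda>\<mu>. (traj A B x \<mu> N, v))"
      by (intro continuous_on_Pair continuous_on_traj continuous_on_const)
    then show "closed {\<mu>. (traj A B x \<mu> N, v) \<in> T}"
      using closed_vimage[OF T] by (simp add: vimage_def)
  qed
  then have cEF: "compact (E \<inter> F)" using E by (rule compact_Int_closed[rotated])
  have low: "\<mu> \<in> E \<inter> F" if S: "\<mu> \<in> ?S" and J: "?J \<mu> \<le> ?J \<mu>0" for \<mu>
  proof -
    have "norm (\<mu> i) \<le> \<rho>" if i: "i < N" for i
    proof -
      have "(wnorm R (\<mu> i - ubar G v))\<^sup>2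
          \<le> (wnorm Q (traj A B x \<mu> i - xbar G v))\<^sup>2 + (wnorm R (\<mu> i - ubar G v))\<^sup>2" by simp
      also have "\<dots> \<le> (\<Sum>i<N. (wnorm Q (traj A B x \<mu> i - xbar G v))\<^sup>2 + (wnorm R (\<mu> i - ubar G v))\<^sup>2)"
        using i by (intro member_le_sum[of i]) auto
      also have "\<dots> \<le> ?J \<mu>" by (simp add: ocp_cost_def)
      finally have "r * (wnorm R (\<mu> i - ubar G v))\<^sup>2 \<le> r * ?J \<mu>0"
        using J r(1) by (intro mult_left_mono) auto
      then have "(norm (\<mu> i - ubar G v))\<^sup>2 \<le> r * ?J \<mu>0"
        using r(2)[of "\<mu> i - ubar G v"] by linarith
      then have "norm (\<mu> i - ubar G v) \<le> sqrt (r * ?J \<mu>0)" by (rule real_le_rsqrt)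
      then show ?thesis unfolding \<rho>_def using norm_triangle_sub[of "\<mu> i" "ubar G v"] by linarith
    qed
    then have "\<mu> \<in> E"
      using S unfolding E_def ocp_feasible_def by (auto simp: PiE_iff extensional_def)
    moreover have "\<mu> \<in> F" using S unfolding F_def ocp_feasible_def by auto
    ultimately show ?thesis by blast
  qed
  have EF: "\<mu> \<in> ?S" if "\<mu> \<in> E \<inter> F" for \<mu>
  proof -
    have "\<mu> i = undefined" if "i \<ge> N" for i
      using \<open>\<mu> \<in> E \<inter> F\<close> that unfolding E_def by (auto simp: PiE_iff dest!: spec[of _ i])
    then show ?thesis using that unfolding F_def ocp_feasible_def by (auto simp: PiE_iff extensional_def)
  qed
  have "continuous_on (E \<inter> F) ?J"
    unfolding ocp_cost_def wnorm_def
    by (intro continuous_on_add continuous_on_sum continuous_on_power continuous_on_real_sqrt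
        continuous_on_inner continuous_on_diff continuous_on_const continuous_on_matrix_vector_mult
        continuous_on_traj continuous_on_coordinate)
  moreover have "E \<inter> F \<noteq> {}" using low[OF \<mu>0] by auto
  ultimately have "\<exists>\<mu>\<in>E \<inter> F. \<forall>\<nu>\<in>E \<inter> F. ?J \<mu> \<le> ?J \<nu>"
    by (intro continuous_attains_inf cEF)
  then obtain \<mu> where \<mu>: "\<mu> \<in> E \<inter> F" "\<And>\<nu>. \<nu> \<in> E \<inter> F \<Longrightarrow> ?J \<mu> \<le> ?J \<nu>" by blast
  have "?J \<mu> \<le> ?J \<nu>" if "\<nu> \<in> ?S" for \<nu>
    using \<mu>(2)[OF low[OF that]] \<mu>(2)[OF low[OF \<mu>0]] by fastforce
  with EF[OF \<mu>(1)] have "is_arg_min ?J (\<lambda>\<mu>. \<mu> \<in> ?S) \<mu>"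
    by (simp add: is_arg_min_linorder)
  then show ?thesis by (rule is_arg_min_arg_min_on)
qed

section \<open>Perturbed Lyapunov sequences\<close>

text \<open>
  Think of \<open>J\<close> as a Lyapunov function, \<open>l\<close> as its decrease and \<open>D\<close> as the square of a perturbation.
  Choose \<open>\<theta>\<close> so small that over a window of length \<open>m\<close> the growth factor \<open>(1 + \<theta>)\<^sup>m\<close> costs at most
  half of the decrease that the upper bound on \<open>J\<close> guarantees. If the window sums stayed above \<open>e\<close>,
  then once \<open>D\<close> is small \<open>J\<close> would drop by a fixed amount per window and become negative.
\<close>
lemma perturbed_descent_window_vanishes:
  fixes J l D :: "nat \<Rightarrow> real"
  assumes nonneg: "\<And>k. 0 \<le> J k" "\<And>k. 0 \<le> l k" "\<And>k. 0 \<le> D k"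
    and D: "D \<longlonglongrightarrow> 0" and c: "0 \<le> c"
    and descent: "\<And>k \<theta>. 0 < \<theta> \<Longrightarrow> J (Suc k) \<le> (1 + \<theta>) * (J k - l k) + (1 + 1/\<theta>) * (c * D k)"
    and C: "1 \<le> C" and upper: "\<And>k. J k \<le> C * (\<Sum>i<m. l (k + i) + D (k + i))"
    and e: "0 < e"
  shows "\<exists>k\<ge>k0. (\<Sum>i<m. l (k + i) + D (k + i)) < e"
proof (rule ccontr)
  define S where "S k = (\<Sum>i<m. l (k + i) + D (k + i))" for k
  define SD where "SD k = (\<Sum>i<m. D (k + i))" for k
  assume "\<not> (\<exists>k\<ge>k0. (\<Sum>i<m. l (k + i) + D (k + i)) < e)"
  then have S_ge: "e \<le> S k" if "k \<ge> k0" for k using that by (force simp: S_def)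
  have "((\<lambda>\<theta>::real. (1 + \<theta>) ^ m) \<longlongrightarrow> (1 + 0) ^ m) (at_right 0)"
    by (intro tendsto_intros)
  then have "\<forall>\<^sub>F \<theta> in at_right 0. (1 + \<theta>) ^ m < 1 + 1 / (2 * C)"
    using C by (intro order_tendstoD(2)) auto
  moreover have "\<forall>\<^sub>F \<theta> in at_right (0::real). 0 < \<theta>" by (rule eventually_at_right_less)
  ultimately have "\<forall>\<^sub>F \<theta> in at_right 0. 0 < \<theta> \<and> (1 + \<theta>) ^ m < 1 + 1 / (2 * C)"
    by eventually_elim simp
  then obtain \<theta> where \<theta>: "0 < \<theta>" "(1 + \<theta>) ^ m < 1 + 1 / (2 * C)"
    using eventually_happens'[of "at_right (0::real)"] by auto
  define K where "K = (1 + 1/\<theta>) * c"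
  have K: "K \<ge> 0" using \<theta>(1) c by (simp add: K_def)
  have SD: "SD k \<ge> 0" for k by (simp add: SD_def sum_nonneg nonneg)
  have window: "J (k + j) + (\<Sum>i<j. l (k + i)) \<le> (1 + \<theta>) ^ j * (J k + K * (\<Sum>i<j. D (k + i)))" for k j
  proof (induction j)
    case (Suc j)
    define s where "s = (\<Sum>i<j. l (k + i))"
    have "0 \<le> \<theta> * l (k + j)" "0 \<le> \<theta> * s"
      unfolding s_def using \<theta>(1) nonneg by (auto intro!: mult_nonneg_nonneg sum_nonneg)
    then have "(1 + \<theta>) * (J (k + j) - l (k + j)) + (s + l (k + j)) \<le> (1 + \<theta>) * (J (k + j) + s)"
      by (simp add: distrib_left distrib_right right_diff_distrib)
    moreover have "J (Suc (k + j)) \<le> (1 + \<theta>) * (J (k + j) - l (k + j)) + K * D (k + j)"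
      using descent[OF \<theta>(1), of "k + j"] by (simp add: K_def mult.assoc)
    ultimately have "J (Suc (k + j)) + (s + l (k + j)) \<le> (1 + \<theta>) * (J (k + j) + s) + K * D (k + j)"
      by linarith
    then have "J (Suc (k + j)) + (\<Sum>i<Suc j. l (k + i))
        \<le> (1 + \<theta>) * (J (k + j) + (\<Sum>i<j. l (k + i))) + K * D (k + j)" by (simp add: s_def)
    also have "\<dots> \<le> (1 + \<theta>) * ((1 + \<theta>) ^ j * (J k + K * (\<Sum>i<j. D (k + i))))
        + (1 + \<theta>) ^ Suc j * (K * D (k + j))"
    proof (rule add_mono)
      show "(1 + \<theta>) * (J (k + j) + (\<Sum>i<j. l (k + i))) \<le> (1 + \<theta>) * ((1 + \<theta>) ^ j * (J k + K * (\<Sum>i<j. D (k + i))))"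
        using Suc \<theta>(1) by (intro mult_left_mono) auto
      have "1 \<le> (1 + \<theta>) ^ Suc j" using \<theta>(1) by (intro one_le_power) simp
      moreover have "0 \<le> K * D (k + j)" using K nonneg by simp
      ultimately show "K * D (k + j) \<le> (1 + \<theta>) ^ Suc j * (K * D (k + j))"
        using mult_right_mono[of 1 "(1 + \<theta>) ^ Suc j" "K * D (k + j)"] by simp
    qed
    also have "\<dots> = (1 + \<theta>) ^ Suc j * (J k + K * (\<Sum>i<Suc j. D (k + i)))"
      by (simp only: power_Suc sum.lessThan_Suc distrib_left mult.assoc add.assoc)
    finally show ?case by simp
  qed simp
  have step: "J (k + m) \<le> J k - S k / 2 + (2 * K + 1) * SD k" for k
  proof -
    have "J (k + m) + (S k - SD k) \<le> (1 + \<theta>) ^ m * (J k + K * SD k)"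
      using window[of k m] by (simp add: S_def SD_def sum.distrib)
    also have "\<dots> \<le> (1 + 1 / (2 * C)) * (J k + K * SD k)"
      using \<theta>(2) nonneg K SD by (intro mult_right_mono) auto
    also have "\<dots> = J k + J k / (2 * C) + (1 + 1 / (2 * C)) * (K * SD k)"
      by (simp add: distrib_left distrib_right)
    also have "\<dots> \<le> J k + S k / 2 + 2 * (K * SD k)"
    proof (intro add_mono order_refl mult_right_mono)
      show "J k / (2 * C) \<le> S k / 2" using upper[of k] C by (simp add: S_def divide_simps mult.commute)
      show "1 + 1 / (2 * C) \<le> 2" using C by simp
      show "0 \<le> K * SD k" using K SD by simp
    qed
    finally show ?thesis by (simp add: algebra_simps)
  qed
  have "SD \<longlonglongrightarrow> (\<Sum>i<m. 0)"
    unfolding SD_def by (intro tendsto_sum LIMSEQ_ignore_initial_segment D)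
  then have "(\<lambda>k. (2 * K + 1) * SD k) \<longlonglongrightarrow> (2 * K + 1) * 0"
    by (intro tendsto_mult tendsto_const) simp
  then have "\<forall>\<^sub>F k in sequentially. (2 * K + 1) * SD k < e / 4"
    using e by (intro order_tendstoD(2)) auto
  then obtain k1 where k1: "\<And>k. k \<ge> k1 \<Longrightarrow> (2 * K + 1) * SD k < e / 4"
    unfolding eventually_sequentially by blast
  define k where "k = max k0 k1"
  have decrease: "J (k + j * m) \<le> J k - real j * (e / 4)" for j
  proof (induction j)
    case (Suc j)
    have "k0 \<le> k + j * m" "k1 \<le> k + j * m" by (simp_all add: k_def)
    then have "J (k + j * m + m) \<le> J (k + j * m) - e / 4"
      using step[of "k + j * m"] k1[of "k + j * m"] S_ge[of "k + j * m"] by linarith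
    moreover have idx: "k + Suc j * m = k + j * m + m" by simp
    moreover have "J k - real (Suc j) * (e / 4) = (J k - real j * (e / 4)) - e / 4" by (simp add: field_simps)
    ultimately show ?case unfolding idx using Suc by linarith
  qed simp
  obtain j where "J k < real j * (e / 4)" using ex_less_of_nat_mult[of "e / 4" "J k"] e by auto
  then show False using decrease[of j] nonneg(1)[of "k + j * m"] by linarith
qed

section \<open>Constrained least squares\<close>

lemma least_squares_minimizer_exists:
  fixes M :: "'a::euclidean_space \<Rightarrow> 'b::euclidean_space"
  assumes "linear M" "inj M" "closed S" "S \<noteq> {}"
  shows "\<exists>a. is_arg_min (\<lambda>v. (norm (M v - p))\<^sup>2) (\<lambda>v. v \<in> S) a"
proof -
  have "closed (M ` S)" using assms closed_injective_linear_image by blast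
  then obtain y where y: "y \<in> M ` S" "\<And>z. z \<in> M ` S \<Longrightarrow> dist p y \<le> dist p z"
    using distance_attains_inf[of "M ` S" p] assms(4) by auto
  then obtain a where a: "a \<in> S" "y = M a" by blast
  have "(norm (M a - p))\<^sup>2 \<le> (norm (M b - p))\<^sup>2" if "b \<in> S" for b
    using y(2)[of "M b"] that a(2) by (intro power_mono) (auto simp: dist_norm norm_minus_commute)
  with a(1) show ?thesis by (auto simp: is_arg_min_linorder)
qed

text \<open>
  The parallelogram identity at the midpoint of \<open>a\<close> and \<open>b\<close>, whose value is at least that at \<open>a\<close>.
\<close>
lemma least_squares_minimizer_gap:
  fixes M :: "'a::real_vector \<Rightarrow> 'b::real_inner"
  assumes M: "linear M" and S: "convex S"
    and a: "is_arg_min (\<lambda>v. (norm (M v - p))\<^sup>2) (\<lambda>v. v \<in> S) a" and b: "b \<in> S"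
  shows "(norm (M (b - a)))\<^sup>2 / 2 \<le> (norm (M b - p))\<^sup>2 - (norm (M a - p))\<^sup>2"
proof -
  define x where "x = M a - p"
  define y where "y = M b - p"
  let ?c = "(1/2) *\<^sub>R a + (1/2) *\<^sub>R b"
  have "a \<in> S" using a by (simp add: is_arg_min_linorder)
  then have "?c \<in> S" using S b by (auto intro: convexD)
  then have "(norm x)\<^sup>2 \<le> (norm (M ?c - p))\<^sup>2"
    using a by (simp add: is_arg_min_linorder x_def)
  also have "M ?c - p = (1/2) *\<^sub>R (x + y)"
  proof -
    have "p = (1/2) *\<^sub>R p + (1/2) *\<^sub>R p" by (simp add: scaleR_left_distrib[symmetric])
    then show ?thesis
      using linear_add[OF M] linear_scale[OF M]
      by (simp add: x_def y_def scaleR_right_distrib scaleR_right_diff_distrib) (simp add: algebra_simps)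
  qed
  also have "(norm \<dots>)\<^sup>2 = (norm (x + y))\<^sup>2 / 4" by (simp add: power_divide)
  finally have "4 * (norm x)\<^sup>2 \<le> (norm (x + y))\<^sup>2" by simp
  moreover have "(norm (x + y))\<^sup>2 + (norm (y - x))\<^sup>2 = 2 * (norm x)\<^sup>2 + 2 * (norm y)\<^sup>2"
    by (simp add: power2_norm_eq_inner inner_add_left inner_add_right inner_diff_left inner_diff_right inner_commute)
  moreover have "y - x = M (b - a)" by (simp add: x_def y_def linear_diff[OF M])
  ultimately show ?thesis unfolding x_def[symmetric] y_def[symmetric] by simp
qed

text \<open>
  Both cases of the governor cost are squared distances under an injective linear map; the target
  space is a product so that one map type serves both.
\<close>
lemma gov_cost_least_squares:
  fixes G :: "real^'nv^('nx::finite + 'nu::finite + 'nz::finite)"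
  obtains M :: "real^'nv \<Rightarrow> (real^'nz) \<times> (real^'nv)" and p where "linear M" "inj M"
    "\<And>v. gov_cost G vs r v = (norm (M v - p))\<^sup>2"
proof (cases "inj ((*v) (Gz G))")
  case True
  show ?thesis
  proof
    show "linear (\<lambda>v. (Gz G *v v, 0 :: real^'nv))"
      by (auto intro!: linearI simp: matrix_vector_right_distrib matrix_vector_mult_scaleR)
    show "inj (\<lambda>v. (Gz G *v v, 0 :: real^'nv))" using True by (auto simp: inj_def)
    show "gov_cost G vs r v = (norm ((Gz G *v v, 0 :: real^'nv) - (r, 0)))\<^sup>2" for v
      using True by (simp add: gov_cost_def norm_Pair)
  qed
next
  case False
  show ?thesis
  proof
    show "linear (\<lambda>v::real^'nv. (0 :: real^'nz, v))" by (auto intro!: linearI)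
    show "inj (\<lambda>v::real^'nv. (0 :: real^'nz, v))" by (auto simp: inj_def)
    show "gov_cost G vs r v = (norm ((0 :: real^'nz, v) - (0, vs)))\<^sup>2" for v
      using False by (simp add: gov_cost_def norm_Pair)
  qed
qed

section \<open>Tracking of slowly varying references\<close>

lemma kernel_basis_equilibrium:
  fixes A :: "real^'nx^'nx" and B :: "real^'nu^'nx" and E :: "real^'nx^'nz" and F :: "real^'nu^'nz"
    and G :: "real^'nv^('nx::finite + 'nu::finite + 'nz::finite)"
  assumes "kernel_basis (equilibrium_matrix A B E F) G"
  shows "A *v xbar G v + B *v ubar G v = xbar G v"
proof -
  let ?Z = "equilibrium_matrix A B E F"
  have "G *v v \<in> span (columns G)" by (rule matrix_vector_mult_in_columnspace)
  then have zero: "?Z *v (G *v v) = 0" using assms by (auto simp: kernel_basis_def)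
  have "((A - mat 1) *v xbar G v + B *v ubar G v) $ a = 0" for a
  proof -
    have x: "(G *v v) $ Inl b = xbar G v $ b" for b
      by (simp add: xbar_def Gx_def matrix_vector_mult_def)
    have u: "(G *v v) $ Inr (Inl b) = ubar G v $ b" for b
      by (simp add: ubar_def Gu_def matrix_vector_mult_def)
    have "(?Z *v (G *v v)) $ Inl a = (\<Sum>j\<in>UNIV <+> (UNIV <+> UNIV). ?Z $ Inl a $ j * (G *v v) $ j)"
      by (simp add: matrix_vector_mult_def[of ?Z])
    also have "\<dots> = (\<Sum>b\<in>UNIV. (A - mat 1) $ a $ b * xbar G v $ b) + (\<Sum>b\<in>UNIV. B $ a $ b * ubar G v $ b)"
      unfolding sum.Plus[OF finite finite] by (simp add: equilibrium_matrix_def x u)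
    also have "\<dots> = ((A - mat 1) *v xbar G v + B *v ubar G v) $ a"
      by (simp add: matrix_vector_mult_def)
    finally show ?thesis by (simp add: zero)
  qed
  then have "(A - mat 1) *v xbar G v + B *v ubar G v = 0" by (simp add: vec_eq_iff)
  then show ?thesis by (simp add: matrix_vector_mult_diff_rdistrib algebra_simps)
qed

text \<open>
  The predictive controller alone, with the reference \<open>v\<close> as a free parameter.
\<close>
locale mpc =
  fixes A :: "real^'nx^'nx" and B :: "real^'nu^'nx"
    and C :: "real^'nx^'ny" and D :: "real^'nu^'ny"
    and G :: "real^'nv^('nx::finite + 'nu::finite + 'nz::finite)"
    and Y :: "(real^'ny) set" and N :: nat and T :: "((real^'nx) \<times> (real^'nv)) set"
    and K :: "real^'nx^'nu" and P Q :: "real^'nx^'nx" and R :: "real^'nu^'nu"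
  assumes equilibrium: "\<And>v. A *v xbar G v + B *v ubar G v = xbar G v"
    and horizon: "1 \<le> N"
    and Y: "polyhedron Y"
    and Q: "symmetric_mat Q" "pos_semidef Q" "observable A Q"
    and R: "symmetric_mat R" "pos_def R"
    and P: "symmetric_mat P" "pos_semidef P"
    and T: "polyhedron T"
    and T_cost: "\<And>x v. (x, v) \<in> T \<Longrightarrow>
        (wnorm P ((A - B ** K) *v (x - xbar G v)))\<^sup>2 - (wnorm P (x - xbar G v))\<^sup>2
          \<le> - (wnorm (Q + transpose K ** R ** K) (x - xbar G v))\<^sup>2"
    and T_inv: "\<And>x v. (x, v) \<in> T \<Longrightarrow> (A *v x + B *v terminal_law G K x v, v) \<in> T"
    and T_con: "\<And>x v. (x, v) \<in> T \<Longrightarrow> C *v x + D *v terminal_law G K x v \<in> Y"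
begin

abbreviation "feasible \<equiv> ocp_feasible A B C D Y N T"
abbreviation "domain \<equiv> ocp_domain A B C D Y N T"
abbreviation "cost \<equiv> ocp_cost A B G N P Q R"
abbreviation "law \<equiv> mpc_law A B C D G Y N T P Q R"
abbreviation "successor \<equiv> closed_loop A B C D G Y N T P Q R"

definition "optimal_inputs x v = arg_min_on (cost x v) (feasible x v)"
definition "optimal_cost x v = cost x v (optimal_inputs x v)"
definition "stage_cost x v = (wnorm Q (x - xbar G v))\<^sup>2 + (wnorm R (law x v - ubar G v))\<^sup>2"

lemma R_psd: "pos_semidef R"
  using R(2) by (rule pos_def_imp_pos_semidef)

lemma optimal_inputs:
  assumes "\<mu> \<in> feasible x v"
  shows "optimal_inputs x v \<in> feasible x v" "optimal_cost x v \<le> cost x v \<mu>"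
  using ocp_minimizer_exists[OF polyhedron_imp_closed[OF Y] polyhedron_imp_closed[OF T] Q(2) R(2) assms, of G P]
    assms unfolding is_arg_min_linorder optimal_cost_def optimal_inputs_def by blast+

lemma domain_iff: "(x, v) \<in> domain \<longleftrightarrow> (\<exists>\<mu>. \<mu> \<in> feasible x v)"
  by (auto simp: ocp_domain_def)

lemma optimal_cost_nonneg: "0 \<le> optimal_cost x v"
  by (simp add: optimal_cost_def ocp_cost_def sum_nonneg)

lemma shifted_inputs:
  assumes "(x, v) \<in> domain"
  obtains \<mu> where "\<mu> \<in> feasible (successor x v) v"
    "cost (successor x v) v \<mu> \<le> optimal_cost x v - stage_cost x v"
proof -
  have opt: "optimal_inputs x v \<in> feasible x v"
    using assms optimal_inputs(1) unfolding domain_iff by blast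
  obtain \<mu> where "\<mu> \<in> feasible (A *v x + B *v optimal_inputs x v 0) v"
    "cost (A *v x + B *v optimal_inputs x v 0) v \<mu> \<le> cost x v (optimal_inputs x v)
      - ((wnorm Q (x - xbar G v))\<^sup>2 + (wnorm R (optimal_inputs x v 0 - ubar G v))\<^sup>2)"
    by (rule ocp_cost_shift[OF Q(2) R_psd T_cost T_inv T_con equilibrium horizon opt]) blast+
  then show ?thesis
    using that by (simp add: closed_loop_def mpc_law_def optimal_inputs_def optimal_cost_def stage_cost_def)
qed

lemma recursive_feasibility: "(x, v) \<in> domain \<Longrightarrow> (successor x v, v) \<in> domain"
  by (rule shifted_inputs) (auto simp: domain_iff)

text \<open>
  Feasible inputs for one parameter are moved to feasible inputs for the other one at a distance
  proportional to that of the parameters. Comparing \<open>v\<close> with \<open>v'\<close> at the same state bounds the effect of a reference change, and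
  comparing \<open>x\<close> with the steady state shows that the optimal cost is at most quadratic in the error.
\<close>
lemma optimal_cost_perturbation:
  obtains c where "c \<ge> 0" "\<And>x v \<mu> x' v' \<theta>. \<mu> \<in> feasible x v \<Longrightarrow> (x', v') \<in> domain \<Longrightarrow> \<theta> > 0 \<Longrightarrow>
    optimal_cost x' v' \<le> (1 + \<theta>) * cost x v \<mu> + (1 + 1/\<theta>) * (c * (norm ((x', v') - (x, v)))\<^sup>2)"
proof -
  obtain L where L: "L \<ge> 0" "\<And>x v x' v' \<mu>. \<mu> \<in> feasible x v \<Longrightarrow> (x', v') \<in> domain \<Longrightarrow>
    \<exists>\<mu>'\<in>feasible x' v'. \<forall>i<N. norm (\<mu>' i - \<mu> i) \<le> L * norm ((x', v') - (x, v))"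
    using feasible_inputs_lipschitz[OF Y T, of A B C D N] by blast
  obtain c where c: "c \<ge> 0" "\<And>x v \<mu> x' v' \<mu>' h \<theta>. \<theta> > 0 \<Longrightarrow> norm (x' - x) \<le> h \<Longrightarrow> norm (v' - v) \<le> h \<Longrightarrow>
      (\<And>j. j < N \<Longrightarrow> norm (\<mu>' j - \<mu> j) \<le> h) \<Longrightarrow>
      cost x' v' \<mu>' \<le> (1 + \<theta>) * cost x v \<mu> + (1 + 1/\<theta>) * (c * h\<^sup>2)"
    by (rule ocp_cost_perturbation[OF Q(1,2) R(1) R_psd P, of N A B G]) blast
  have "optimal_cost x' v' \<le> (1 + \<theta>) * cost x v \<mu> + (1 + 1/\<theta>) * (c * (L + 1)\<^sup>2 * (norm ((x', v') - (x, v)))\<^sup>2)"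
    if \<mu>: "\<mu> \<in> feasible x v" and dom: "(x', v') \<in> domain" and \<theta>: "\<theta> > 0" for x v \<mu> x' v' \<theta>
  proof -
    define n where "n = norm ((x', v') - (x, v))"
    define h where "h = (L + 1) * n"
    have n: "0 \<le> n" by (simp add: n_def)
    obtain \<mu>' where \<mu>': "\<mu>' \<in> feasible x' v'" "\<And>i. i < N \<Longrightarrow> norm (\<mu>' i - \<mu> i) \<le> L * n"
      using L(2)[OF \<mu> dom] unfolding n_def by blast
    have "0 \<le> L * n" using L(1) n by simp
    then have h: "n \<le> h" "L * n \<le> h" using n by (simp_all add: h_def distrib_right)
    have "norm (x' - x) \<le> n" "norm (v' - v) \<le> n"
      using norm_fst_le[of "x' - x" "v' - v"] norm_snd_le[of "v' - v" "x' - x"] by (simp_all add: n_def)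
    then have "cost x' v' \<mu>' \<le> (1 + \<theta>) * cost x v \<mu> + (1 + 1/\<theta>) * (c * h\<^sup>2)"
      using h \<mu>'(2) by (intro c(2)[OF \<theta>]) (auto intro: order_trans)
    moreover have "optimal_cost x' v' \<le> cost x' v' \<mu>'" by (rule optimal_inputs(2)[OF \<mu>'(1)])
    ultimately show ?thesis by (simp add: h_def n_def power_mult_distrib mult.assoc)
  qed
  moreover have "c * (L + 1)\<^sup>2 \<ge> 0" using c(1) by simp
  ultimately show ?thesis using that by blast
qed

text \<open>
  Feasibility of any state for the reference \<open>v\<close> yields a point of the terminal set with this
  reference, and therefore the steady state itself.
\<close>
lemma steady_inputs_feasible:
  assumes "(x, v) \<in> domain"
  shows "restrict (\<lambda>_. ubar G v) {..<N} \<in> feasible (xbar G v) v"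
    and "cost (xbar G v) v (restrict (\<lambda>_. ubar G v) {..<N}) = 0"
proof -
  let ?\<mu> = "restrict (\<lambda>_. ubar G v) {..<N}"
  obtain z where "(z, v) \<in> T" using assms by (auto simp: domain_iff ocp_feasible_def)
  then have T': "(xbar G v, v) \<in> T"
    using terminal_set_contains_steady_state[OF Q R(2) polyhedron_imp_closed[OF T] T_cost T_inv equilibrium] by blast
  have tr: "traj A B (xbar G v) ?\<mu> i = xbar G v" if "i \<le> N" for i
    using that by (intro traj_equilibrium[OF equilibrium]) auto
  have "C *v xbar G v + D *v ubar G v \<in> Y" using T_con[OF T'] by (simp add: terminal_law_def)
  with T' show "?\<mu> \<in> feasible (xbar G v) v" by (simp add: ocp_feasible_def tr)
  show "cost (xbar G v) v ?\<mu> = 0" by (simp add: ocp_cost_def tr wnorm_def)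
qed

text \<open>
  The Lyapunov function is the optimal cost. It decreases by the stage cost, up to a term in the
  squared reference increment; observability bounds the squared error, and with it the optimal cost,
  by the stage costs and increments in a window.
\<close>
lemma tracking_error_frequently_small:
  assumes dom: "\<And>k. (x k, v k) \<in> domain"
    and step: "\<And>k. x (Suc k) = successor (x k) (v k)"
    and slow: "(\<lambda>k. v (Suc k) - v k) \<longlonglongrightarrow> 0"
    and \<eta>: "\<eta> > 0"
  shows "\<exists>k\<ge>k0. norm (x k - xbar G (v k)) < \<eta>"
proof -
  define \<delta> where "\<delta> k = x k - xbar G (v k)" for k
  define J where "J k = optimal_cost (x k) (v k)" for k
  define l where "l k = stage_cost (x k) (v k)" for k
  define d where "d k = (norm (v (Suc k) - v k))\<^sup>2" for k
  have nonneg: "0 \<le> J k" "0 \<le> l k" "0 \<le> d k" for k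
    by (simp_all add: J_def l_def d_def optimal_cost_nonneg stage_cost_def)
  obtain c where c: "c \<ge> 0" "\<And>x v \<mu> x' v' \<theta>. \<mu> \<in> feasible x v \<Longrightarrow> (x', v') \<in> domain \<Longrightarrow> \<theta> > 0 \<Longrightarrow>
    optimal_cost x' v' \<le> (1 + \<theta>) * cost x v \<mu> + (1 + 1/\<theta>) * (c * (norm ((x', v') - (x, v)))\<^sup>2)"
    by (rule optimal_cost_perturbation) blast
  have descent: "J (Suc k) \<le> (1 + \<theta>) * (J k - l k) + (1 + 1/\<theta>) * (c * d k)" if \<theta>: "0 < \<theta>" for k \<theta>
  proof -
    obtain \<mu> where \<mu>: "\<mu> \<in> feasible (x (Suc k)) (v k)" "cost (x (Suc k)) (v k) \<mu> \<le> J k - l k"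
      using shifted_inputs[OF dom[of k]] unfolding J_def l_def step by blast
    have "J (Suc k) \<le> (1 + \<theta>) * cost (x (Suc k)) (v k) \<mu>
        + (1 + 1/\<theta>) * (c * (norm ((x (Suc k), v (Suc k)) - (x (Suc k), v k)))\<^sup>2)"
      unfolding J_def by (rule c(2)[OF \<mu>(1) dom \<theta>])
    also have "\<dots> \<le> (1 + \<theta>) * (J k - l k) + (1 + 1/\<theta>) * (c * d k)"
      using \<mu>(2) \<theta> c(1) by (intro add_mono mult_left_mono) (auto simp: d_def norm_Pair)
    finally show ?thesis .
  qed
  have J_le: "J k \<le> 2 * c * (norm (\<delta> k))\<^sup>2" for k
    using c(2)[OF steady_inputs_feasible(1)[OF dom[of k]] dom[of k], of 1]
    by (simp add: steady_inputs_feasible(2)[OF dom[of k]] J_def \<delta>_def norm_Pair)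
  obtain w c1 where c1: "c1 \<ge> 1" "\<And>\<delta> e. (\<And>i. \<delta> (Suc i) = A *v \<delta> i + e i) \<Longrightarrow>
      (norm (\<delta> 0))\<^sup>2 \<le> c1 * (\<Sum>i<w. (norm (Q *v \<delta> i))\<^sup>2 + (norm (e i))\<^sup>2)"
    by (rule observable_window_estimate[OF Q(3)]) blast
  obtain b where b: "b \<ge> 1"
    "\<And>y u. (norm (Q *v y))\<^sup>2 + (norm (B *v u))\<^sup>2 \<le> b * ((wnorm Q y)\<^sup>2 + (wnorm R u)\<^sup>2)"
    by (rule weighted_squares_bound[OF Q(1,2) R(2)]) blast
  obtain g where g: "g \<ge> 1" "\<And>v. norm (Gx G *v v) \<le> g * norm v"
    using matrix_vector_norm_bound[of "Gx G"] by blast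
  define e where "e k = B *v (law (x k) (v k) - ubar G (v k)) - Gx G *v (v (Suc k) - v k)" for k
  have error: "\<delta> (Suc k) = A *v \<delta> k + e k" for k
  proof -
    have "\<delta> (Suc k) = A *v x k + B *v law (x k) (v k) - (A *v xbar G (v k) + B *v ubar G (v k))
        + xbar G (v k) - xbar G (v (Suc k))"
      by (simp add: \<delta>_def step closed_loop_def equilibrium)
    then show ?thesis
      by (simp add: \<delta>_def e_def xbar_def matrix_vector_mult_diff_distrib algebra_simps)
  qed
  define c2 where "c2 = c1 * (2 * b + 2 * g\<^sup>2)"
  have c2: "c2 \<ge> 1"
  proof -
    have "1 \<le> 2 * b + 2 * g\<^sup>2" using b(1) by (simp add: add_increasing2)
    then show ?thesis unfolding c2_def using c1(1) mult_mono[of 1 c1 1 "2 * b + 2 * g\<^sup>2"] by simp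
  qed
  have \<delta>_le: "(norm (\<delta> k))\<^sup>2 \<le> c2 * (\<Sum>i<w. l (k + i) + d (k + i))" for k
  proof -
    have le: "(norm (Q *v \<delta> j))\<^sup>2 + (norm (e j))\<^sup>2 \<le> (2 * b + 2 * g\<^sup>2) * (l j + d j)" for j
    proof -
      let ?u = "B *v (law (x j) (v j) - ubar G (v j))" and ?g = "Gx G *v (v (Suc j) - v j)"
      have "norm (e j) \<le> norm ?u + norm ?g" unfolding e_def by (rule norm_triangle_ineq4)
      then have "(norm (e j))\<^sup>2 \<le> (norm ?u + norm ?g)\<^sup>2" by (intro power_mono) auto
      also have "\<dots> \<le> 2 * (norm ?u)\<^sup>2 + 2 * (norm ?g)\<^sup>2"
        using sum_squares_bound[of "norm ?u" "norm ?g"] by (simp add: power2_sum)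
      also have "(norm ?g)\<^sup>2 \<le> g\<^sup>2 * d j"
        using power_mono[OF g(2)[of "v (Suc j) - v j"], of 2] by (simp add: d_def power_mult_distrib)
      finally have "(norm (e j))\<^sup>2 \<le> 2 * (norm ?u)\<^sup>2 + 2 * (g\<^sup>2 * d j)" by simp
      moreover have "(norm (Q *v \<delta> j))\<^sup>2 + (norm ?u)\<^sup>2 \<le> b * l j"
        using b(2)[of "\<delta> j" "law (x j) (v j) - ubar G (v j)"] by (simp add: l_def stage_cost_def \<delta>_def)
      moreover have "0 \<le> b * d j" "0 \<le> g\<^sup>2 * l j" "0 \<le> (norm (Q *v \<delta> j))\<^sup>2" using b(1) nonneg by auto
      moreover have "(2 * b + 2 * g\<^sup>2) * (l j + d j) = 2 * (b * l j) + 2 * (b * d j) + 2 * (g\<^sup>2 * l j) + 2 * (g\<^sup>2 * d j)"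
        by (simp add: algebra_simps)
      ultimately show ?thesis by linarith
    qed
    have "(norm (\<delta> (k + 0)))\<^sup>2 \<le> c1 * (\<Sum>i<w. (norm (Q *v \<delta> (k + i)))\<^sup>2 + (norm (e (k + i)))\<^sup>2)"
      by (rule c1(2)[of "\<lambda>i. \<delta> (k + i)"]) (simp only: add_Suc_right error)
    also have "\<dots> \<le> c1 * (\<Sum>i<w. (2 * b + 2 * g\<^sup>2) * (l (k + i) + d (k + i)))"
      using c1(1) by (intro mult_left_mono sum_mono le) simp
    also have "\<dots> = c2 * (\<Sum>i<w. l (k + i) + d (k + i))"
      by (simp only: c2_def sum_distrib_left mult.assoc)
    finally show ?thesis by simp
  qed
  define c3 where "c3 = (2 * c + 1) * c2"
  have c3: "c3 \<ge> 1" unfolding c3_def using c(1) c2 mult_mono[of 1 "2 * c + 1" 1 c2] by simp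
  have upper: "J k \<le> c3 * (\<Sum>i<w. l (k + i) + d (k + i))" for k
  proof -
    have "J k \<le> (2 * c + 1) * (norm (\<delta> k))\<^sup>2" using J_le[of k] by (simp add: distrib_right add_increasing2)
    also have "\<dots> \<le> (2 * c + 1) * (c2 * (\<Sum>i<w. l (k + i) + d (k + i)))"
      using c(1) by (intro mult_left_mono \<delta>_le) auto
    finally show ?thesis by (simp add: c3_def mult.assoc)
  qed
  have "(\<lambda>k. norm (v (Suc k) - v k)) \<longlonglongrightarrow> 0" using tendsto_norm[OF slow] by simp
  from tendsto_power[OF this, of 2] have d_lim: "d \<longlonglongrightarrow> 0" unfolding d_def by simp
  have "\<exists>k\<ge>k0. (\<Sum>i<w. l (k + i) + d (k + i)) < \<eta>\<^sup>2 / c2"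
    using \<eta> c2 by (intro perturbed_descent_window_vanishes[OF nonneg d_lim c(1) descent c3 upper]) auto
  then obtain k where k: "k \<ge> k0" "(\<Sum>i<w. l (k + i) + d (k + i)) < \<eta>\<^sup>2 / c2" by blast
  have "c2 * (\<Sum>i<w. l (k + i) + d (k + i)) < \<eta>\<^sup>2"
    using k(2) c2 by (simp add: pos_less_divide_eq mult.commute)
  then have "(norm (\<delta> k))\<^sup>2 < \<eta>\<^sup>2" using \<delta>_le[of k] by linarith
  then have "norm (\<delta> k) < \<eta>" using \<eta> power2_less_imp_less[of "norm (\<delta> k)" \<eta>] by simp
  then show ?thesis using k(1) unfolding \<delta>_def by blast
qed

end

section \<open>Finite-time convergence of the reference\<close>

text \<open>
  The governor without the controller: all that matters about the closed loop is that the tracking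
  error becomes small at arbitrarily late times if the reference increments tend to zero. This
  hypothesis applies because the squared increments are dominated by the decrements of the
  convergent sequence \<open>\<psi> (v k)\<close>. At a late time with a small error the governor either reaches \<open>vs\<close>
  or could lower \<open>\<psi>\<close> by the amount \<open>\<gamma>\<close>, which exceeds all late decrements.
\<close>
lemma governor_reaches_optimum:
  fixes M :: "'v::euclidean_space \<Rightarrow> 'b::euclidean_space" and h :: "'v \<Rightarrow> 'x::euclidean_space"
    and \<F> :: "('x \<times> 'v) set"
  assumes M: "linear M" "inj M" and \<psi>: "\<And>w. \<psi> w = (norm (M w - p))\<^sup>2"
    and V: "closed V" "convex V" and \<F>: "convex \<F>"
    and vs: "is_arg_min \<psi> (\<lambda>w. w \<in> V) vs"
    and h: "linear h" and steady: "\<And>w. w \<in> V \<Longrightarrow> (h w, w) \<in> interior \<F>"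
    and v0: "v 0 \<in> V"
    and update: "\<And>k. (x (Suc k), v k) \<in> \<F> \<Longrightarrow> v k \<in> V \<Longrightarrow>
        is_arg_min \<psi> (\<lambda>w. w \<in> {w. (x (Suc k), w) \<in> \<F> \<and> w \<in> V}) (v (Suc k))"
    and hold: "\<And>k. (x (Suc k), v k) \<notin> \<F> \<Longrightarrow> v k \<in> V \<Longrightarrow> v (Suc k) = v k"
    and tracking: "\<And>\<eta> k0. (\<lambda>k. v (Suc k) - v k) \<longlonglongrightarrow> 0 \<Longrightarrow> \<eta> > 0 \<Longrightarrow> \<exists>k\<ge>k0. norm (x k - h (v k)) < \<eta>"
  shows "\<exists>t. \<forall>k\<ge>t. v k = vs"
proof -
  define S where "S k = {w. (x (Suc k), w) \<in> \<F> \<and> w \<in> V}" for k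
  have S: "convex (S k)" for k
  proof (rule convexI)
    fix a b :: 'v and s t :: real
    assume *: "a \<in> S k" "b \<in> S k" "0 \<le> s" "0 \<le> t" "s + t = 1"
    have "s *\<^sub>R (x (Suc k), a) + t *\<^sub>R (x (Suc k), b) \<in> \<F>"
      using * \<F> by (intro convexD) (auto simp: S_def)
    moreover have "s *\<^sub>R x (Suc k) + t *\<^sub>R x (Suc k) = x (Suc k)"
      using *(5) by (simp add: scaleR_left_distrib[symmetric])
    moreover have "s *\<^sub>R a + t *\<^sub>R b \<in> V" using * V(2) by (intro convexD) (auto simp: S_def)
    ultimately show "s *\<^sub>R a + t *\<^sub>R b \<in> S k" by (simp add: S_def)
  qed
  obtain \<beta> where \<beta>: "\<beta> > 0" "\<And>w. \<beta> * norm w \<le> norm (M w)"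
    using linear_inj_bounded_below_pos[OF M] by blast
  have gap: "(\<beta> * norm (b - a))\<^sup>2 / 2 \<le> \<psi> b - \<psi> a"
    if "is_arg_min \<psi> (\<lambda>w. w \<in> X) a" "convex X" "b \<in> X" for X a b
  proof -
    have "\<psi> = (\<lambda>w. (norm (M w - p))\<^sup>2)" using \<psi> by auto
    then have "(norm (M (b - a)))\<^sup>2 / 2 \<le> \<psi> b - \<psi> a"
      using least_squares_minimizer_gap[OF M(1) that(2), of p a b] that by simp
    moreover have "(\<beta> * norm (b - a))\<^sup>2 \<le> (norm (M (b - a)))\<^sup>2"
      using \<beta> by (intro power_mono) auto
    ultimately show ?thesis by linarith
  qed
  have vsV: "vs \<in> V" and vs_min: "\<And>w. w \<in> V \<Longrightarrow> \<psi> vs \<le> \<psi> w"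
    using vs by (auto simp: is_arg_min_linorder)
  have unique: "w = vs" if "w \<in> V" "\<psi> w \<le> \<psi> vs" for w
  proof -
    have "(\<beta> * norm (w - vs))\<^sup>2 \<le> 0" using gap[OF vs V(2) that(1)] that(2) by linarith
    then show ?thesis using \<beta>(1) by simp
  qed
  have vV: "v k \<in> V" for k
  proof (induction k)
    case (Suc k)
    then show ?case
      using update[of k] hold[of k] by (cases "(x (Suc k), v k) \<in> \<F>") (auto simp: is_arg_min_linorder)
  qed (rule v0)
  have upd: "is_arg_min \<psi> (\<lambda>w. w \<in> S k) (v (Suc k))" if "(x (Suc k), v k) \<in> \<F>" for k
    unfolding S_def using update[OF that vV] .
  define g where "g k = \<psi> (v k) - \<psi> (v (Suc k))" for k
  have g_ge: "(\<beta> * norm (v (Suc k) - v k))\<^sup>2 / 2 \<le> g k" for k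
  proof (cases "(x (Suc k), v k) \<in> \<F>")
    case True
    then have "v k \<in> S k" using vV by (simp add: S_def)
    from gap[OF upd[OF True] S this] show ?thesis by (simp add: g_def norm_minus_commute)
  next
    case False
    then show ?thesis using hold[OF False vV] by (simp add: g_def)
  qed
  then have g0: "0 \<le> g k" for k
    by (rule order_trans[rotated]) simp
  have \<psi>0: "0 \<le> \<psi> w" for w by (simp add: \<psi>)
  have dec: "decseq (\<lambda>k. \<psi> (v k))"
    using g0 by (intro decseq_SucI) (simp add: g_def)
  then obtain l where l: "(\<lambda>k. \<psi> (v k)) \<longlonglongrightarrow> l"
    using decseq_convergent[OF dec, of 0] \<psi>0 by blast
  have g_lim: "g \<longlonglongrightarrow> 0"
    using tendsto_diff[OF l LIMSEQ_Suc[OF l]] unfolding g_def by simp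
  have norm_le: "norm (v (Suc k) - v k) \<le> sqrt (2 * g k) / \<beta>" for k
  proof -
    have "\<beta> * norm (v (Suc k) - v k) \<le> sqrt (2 * g k)"
      using g_ge[of k] by (intro real_le_rsqrt) simp
    then show ?thesis using \<beta>(1) by (simp add: pos_le_divide_eq mult.commute)
  qed
  have "(\<lambda>k. sqrt (2 * g k) / \<beta>) \<longlonglongrightarrow> sqrt (2 * 0) / \<beta>"
    using \<beta>(1) by (intro tendsto_intros g_lim) auto
  then have sq_lim: "(\<lambda>k. sqrt (2 * g k) / \<beta>) \<longlonglongrightarrow> 0" by simp
  then have norm_lim: "(\<lambda>k. norm (v (Suc k) - v k)) \<longlonglongrightarrow> 0"
    by (rule tendsto_sandwich[OF _ _ tendsto_const, rotated 2]) (auto intro!: always_eventually norm_le)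
  then have slow: "(\<lambda>k. v (Suc k) - v k) \<longlonglongrightarrow> 0" by (rule tendsto_norm_zero_cancel)
  \<comment> \<open>\<open>V\<close> may be unbounded, but the references stay in a sublevel set, over which the steady states
    have a uniform margin \<open>\<delta>\<close> inside \<open>\<F>\<close>\<close>
  define W where "W = {w \<in> V. \<psi> w \<le> \<psi> (v 0)}"
  have vW: "v k \<in> W" for k using decseqD[OF dec, of 0 k] vV by (simp add: W_def)
  have vsW: "vs \<in> W" using vsV vs_min[OF v0] by (simp add: W_def)
  have "norm w \<le> (sqrt (\<psi> (v 0)) + norm p) / \<beta>" if "w \<in> W" for w
  proof -
    have "norm (M w - p) \<le> sqrt (\<psi> (v 0))"
      using that by (intro real_le_rsqrt) (simp add: W_def \<psi>)
    then have "\<beta> * norm w \<le> sqrt (\<psi> (v 0)) + norm p"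
      using \<beta>(2)[of w] norm_triangle_sub[of "M w" p] by linarith
    then show ?thesis using \<beta>(1) by (simp add: pos_le_divide_eq mult.commute)
  qed
  then have bW: "bounded W" unfolding bounded_iff by blast
  have "continuous_on UNIV \<psi>"
  proof -
    have "continuous_on UNIV (\<lambda>w. (norm (M w - p))\<^sup>2)"
      using linear_continuous_on[OF linear_conv_bounded_linear[THEN iffD1, OF M(1)]]
      by (intro continuous_intros)
    moreover have "\<psi> = (\<lambda>w. (norm (M w - p))\<^sup>2)" using \<psi> by auto
    ultimately show ?thesis by simp
  qed
  then have "closed {w. \<psi> w \<le> \<psi> (v 0)}" by (intro closed_Collect_le continuous_on_const) 
  moreover have "W = V \<inter> {w. \<psi> w \<le> \<psi> (v 0)}" by (auto simp: W_def)
  ultimately have "compact W" using bW V(1) by (simp add: compact_eq_bounded_closed closed_Int)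
  moreover have "continuous_on W (\<lambda>w. (h w, w))"
    using linear_continuous_on[OF linear_conv_bounded_linear[THEN iffD1, OF h]]
    by (intro continuous_intros)
  ultimately have "compact ((\<lambda>w. (h w, w)) ` W)" by (intro compact_continuous_image)
  moreover have "(\<lambda>w. (h w, w)) ` W \<subseteq> interior \<F>" using steady by (auto simp: W_def)
  ultimately obtain \<delta> where \<delta>: "\<delta> > 0" "(\<Union>q\<in>(\<lambda>w. (h w, w)) ` W. ball q \<delta>) \<subseteq> interior \<F>"
    by (rule compact_subset_open_imp_ball_epsilon_subset[OF _ open_interior])
  have near: "(y, w') \<in> \<F>" if "w \<in> W" "norm (y - h w) < \<delta> / 2" "norm (w' - w) \<le> \<delta> / 2" for y w w'
  proof -
    have "norm ((y, w') - (h w, w)) \<le> norm (y - h w) + norm (w' - w)"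
      using norm_Pair_le[of "y - h w" "w' - w"] by simp
    then have "(y, w') \<in> ball (h w, w) \<delta>"
      unfolding mem_ball dist_norm norm_minus_commute[of "(h w, w)" "(y, w')"] using that by linarith
    then show ?thesis using \<delta>(2) that(1) interior_subset by blast
  qed
  obtain d where d: "d > 0" "\<And>w. w \<in> W \<Longrightarrow> norm (vs - w) \<le> d"
  proof -
    obtain b where "b > 0" "\<And>w. w \<in> W \<Longrightarrow> norm w \<le> b" using bW bounded_pos by blast
    then show ?thesis using that[of "2 * b"] vsW norm_triangle_ineq4[of vs] by (smt (verit))
  qed
  \<comment> \<open>a step of relative length \<open>\<tau>\<close> towards \<open>vs\<close> uses at most half of the margin, from any reference in \<open>W\<close>\<close>
  define \<tau> where "\<tau> = min 1 (\<delta> / (2 * d))"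
  have \<tau>: "0 < \<tau>" "\<tau> \<le> 1" "\<tau> * d \<le> \<delta> / 2"
  proof -
    show "0 < \<tau>" "\<tau> \<le> 1" using \<delta>(1) d(1) by (auto simp: \<tau>_def)
    have "\<tau> * d \<le> \<delta> / (2 * d) * d" using d(1) by (intro mult_right_mono) (auto simp: \<tau>_def)
    then show "\<tau> * d \<le> \<delta> / 2" using d(1) by simp
  qed
  \<comment> \<open>a lower bound for the decrease of \<open>\<psi>\<close> by such a step, if \<open>vs\<close> is at least half the margin away\<close>
  define \<gamma> where "\<gamma> = \<tau> * ((\<beta> * (\<delta> / 2))\<^sup>2 / 2)"
  have \<gamma>: "\<gamma> > 0" using \<tau>(1) \<beta>(1) \<delta>(1) by (simp add: \<gamma>_def)
  obtain H where H: "H > 0" "\<And>w. norm (h w) \<le> H * norm w"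
    using linear_bounded_pos[OF h] by blast
  have "\<forall>\<^sub>F k in sequentially. g k < \<gamma>" using order_tendstoD(2)[OF g_lim \<gamma>] .
  moreover have "\<forall>\<^sub>F k in sequentially. norm (v (Suc k) - v k) < \<delta> / (4 * H)"
    using order_tendstoD(2)[OF norm_lim, of "\<delta> / (4 * H)"] \<delta>(1) H(1) by simp
  ultimately have "\<forall>\<^sub>F k in sequentially. g k < \<gamma> \<and> norm (v (Suc k) - v k) < \<delta> / (4 * H)"
    by eventually_elim simp
  then obtain k1 where k1: "\<And>k. k \<ge> k1 \<Longrightarrow> g k < \<gamma>" "\<And>k. k \<ge> k1 \<Longrightarrow> norm (v (Suc k) - v k) < \<delta> / (4 * H)"
    unfolding eventually_sequentially by blast
  \<comment> \<open>\<open>k'\<close> is kept positive because the governor compares the new state with the previous reference\<close>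
  obtain k' where k': "k' \<ge> Suc k1" "norm (x k' - h (v k')) < \<delta> / 4"
    using tracking[OF slow, of "\<delta> / 4" "Suc k1"] \<delta>(1) by auto
  then obtain j where j: "k' = Suc j" "j \<ge> k1" by (cases k') auto
  have close: "norm (x (Suc j) - h (v j)) < \<delta> / 2"
  proof -
    have "norm (h (v (Suc j) - v j)) \<le> H * (\<delta> / (4 * H))"
      using H(2)[of "v (Suc j) - v j"] mult_left_mono[of _ _ H] k1(2)[OF j(2)] H(1)
      by (meson less_imp_le order_trans)
    then have "norm (h (v (Suc j)) - h (v j)) \<le> \<delta> / 4" using H(1) by (simp add: linear_diff[OF h])
    then show ?thesis
      using k'(2) norm_triangle_ineq[of "x (Suc j) - h (v (Suc j))" "h (v (Suc j)) - h (v j)"]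
      by (simp add: j(1))
  qed
  have inF: "(x (Suc j), v j) \<in> \<F>" using near[OF vW close, of "v j"] \<delta>(1) by simp
  have min: "\<psi> (v (Suc j)) \<le> \<psi> w" if "w \<in> V" "norm (w - v j) \<le> \<delta> / 2" for w
    using upd[OF inF] near[OF vW close that(2)] that(1) by (simp add: is_arg_min_linorder S_def)
  have "norm (vs - v j) < \<delta> / 2"
  proof (rule ccontr)
    assume "\<not> norm (vs - v j) < \<delta> / 2"
    then have far: "\<delta> / 2 \<le> norm (v j - vs)" by (simp add: norm_minus_commute)
    define w where "w = (1 - \<tau>) *\<^sub>R v j + \<tau> *\<^sub>R vs"
    have "w \<in> V" unfolding w_def using V(2) vV vsV \<tau> by (intro convexD) auto
    moreover have "norm (w - v j) \<le> \<delta> / 2"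
    proof -
      have "w - v j = \<tau> *\<^sub>R (vs - v j)" by (simp add: w_def algebra_simps)
      then have "norm (w - v j) = \<tau> * norm (vs - v j)" using \<tau>(1) by simp
      also have "\<dots> \<le> \<tau> * d" using d(2)[OF vW] \<tau>(1) by (intro mult_left_mono) auto
      finally show ?thesis using \<tau>(3) by linarith
    qed
    ultimately have "\<psi> (v (Suc j)) \<le> \<psi> w" by (rule min)
    also have "\<psi> w \<le> (1 - \<tau>) * \<psi> (v j) + \<tau> * \<psi> vs"
    proof -
      let ?a = "M (v j) - p" and ?b = "M vs - p"
      have "M w - p = (1 - \<tau>) *\<^sub>R ?a + \<tau> *\<^sub>R ?b"
        unfolding w_def linear_add[OF M(1)] linear_scale[OF M(1)] by (simp add: algebra_simps)
      then have "norm (M w - p) \<le> (1 - \<tau>) * norm ?a + \<tau> * norm ?b"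
        using norm_triangle_ineq[of "(1 - \<tau>) *\<^sub>R ?a" "\<tau> *\<^sub>R ?b"] \<tau> by simp
      then have "\<psi> w \<le> ((1 - \<tau>) * norm ?a + \<tau> * norm ?b)\<^sup>2"
        unfolding \<psi> by (intro power_mono) auto
      also have "\<dots> = (1 - \<tau>) * (norm ?a)\<^sup>2 + \<tau> * (norm ?b)\<^sup>2 - \<tau> * (1 - \<tau>) * (norm ?a - norm ?b)\<^sup>2"
        by (simp add: power2_eq_square algebra_simps)
      also have "\<dots> \<le> (1 - \<tau>) * (norm ?a)\<^sup>2 + \<tau> * (norm ?b)\<^sup>2" using \<tau> by simp
      finally show ?thesis by (simp add: \<psi>)
    qed
    finally have "\<tau> * (\<psi> (v j) - \<psi> vs) \<le> g j" by (simp add: g_def algebra_simps)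
    moreover have "(\<beta> * (\<delta> / 2))\<^sup>2 / 2 \<le> \<psi> (v j) - \<psi> vs"
    proof -
      have "(\<beta> * (\<delta> / 2))\<^sup>2 \<le> (\<beta> * norm (v j - vs))\<^sup>2"
        using far \<beta>(1) \<delta>(1) by (intro power_mono mult_left_mono) auto
      then show ?thesis using gap[OF vs V(2) vV[of j]] by linarith
    qed
    then have "\<gamma> \<le> \<tau> * (\<psi> (v j) - \<psi> vs)" unfolding \<gamma>_def using \<tau>(1) by (intro mult_left_mono) auto
    ultimately show False using k1(1)[OF j(2)] by linarith
  qed
  then have start: "v (Suc j) = vs" using unique[OF vV] min[OF vsV] by simp
  have "v (Suc j + i) = vs" for i
  proof (induction i)
    case (Suc i)
    then have "\<psi> (v (Suc (Suc j + i))) \<le> \<psi> vs" using g0[of "Suc j + i"] by (simp add: g_def)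
    then show ?case using unique[OF vV] by simp
  qed (simp add: start)
  then show ?thesis by (metis le_Suc_ex)
qed

theorem theorem4:
  fixes A :: "real^'nx^'nx" and B :: "real^'nu^'nx"
    and C :: "real^'nx^'ny" and D :: "real^'nu^'ny"
    and E :: "real^'nx^'nz" and F :: "real^'nu^'nz"
    and G :: "real^'nv^('nx::finite + 'nu::finite + 'nz::finite)"
    and Y :: "(real^'ny) set" and \<epsilon> :: real
    and N :: nat and T :: "((real^'nx) \<times> (real^'nv)) set" and K :: "real^'nx^'nu"
    and P Q :: "real^'nx^'nx" and R :: "real^'nu^'nu"
    and \<F> \<Gamma> :: "((real^'nx) \<times> (real^'nv)) set" and V :: "(real^'nv) set"
    and r :: "real^'nz" and vs :: "real^'nv"
  assumes G: "kernel_basis (equilibrium_matrix A B E F) G"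
    and eps: "0 < \<epsilon>" "\<epsilon> < 1"
    and N: "1 \<le> N"
    and V_def: "V = V_eps C D G Y \<epsilon>"
    and Gamma_def: "\<Gamma> = ocp_domain A B C D Y N T"
    and stab: "stabilizable A B"
    and Y: "compact Y" "polyhedron Y" "0 \<in> interior Y"
    and Gz: "full_rank (Gz G)"
    and Q: "symmetric_mat Q" "pos_semidef Q" "observable A Q"
    and R: "symmetric_mat R" "pos_def R"
    and P: "symmetric_mat P" "pos_semidef P"
    and T_poly: "polyhedron T"
    and T_cost: "\<And>x v. (x, v) \<in> T \<Longrightarrow>
        (wnorm P ((A - B ** K) *v (x - xbar G v)))\<^sup>2 - (wnorm P (x - xbar G v))\<^sup>2
          \<le> - (wnorm (Q + transpose K ** R ** K) (x - xbar G v))\<^sup>2"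
    and T_inv: "\<And>x v. (x, v) \<in> T \<Longrightarrow> (A *v x + B *v terminal_law G K x v, v) \<in> T"
    and T_con: "\<And>x v. (x, v) \<in> T \<Longrightarrow> C *v x + D *v terminal_law G K x v \<in> Y"
    and Sigma_Gamma: "steady_set C D G Y \<epsilon> \<subseteq> interior \<Gamma>"
    and F_sub: "\<F> \<subseteq> \<Gamma>"
    and F_poly: "closed \<F>" "convex \<F>" "polyhedron \<F>"
    and Sigma_F: "steady_set C D G Y \<epsilon> \<subseteq> interior \<F>"
    and vs: "is_arg_min (\<lambda>v. (norm (Gz G *v v - r))\<^sup>2) (\<lambda>v. v \<in> V) vs"
  shows "\<forall>x0 \<in> fst ` gov_Phi \<F> V.
           \<forall>x v. x 0 = x0 \<and> v 0 = gov_gbar G \<F> V vs r x0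
             \<and> (\<forall>k::nat. x (Suc k) = closed_loop A B C D G Y N T P Q R (x k) (v k)
                     \<and> v (Suc k) = gov_g G \<Gamma> \<F> V vs r (x (Suc k)) (v k))
           \<longrightarrow> (\<exists>t. \<forall>k\<ge>t. v k = vs)"
proof (intro ballI allI impI)
  fix x0 :: "real^'nx" and x :: "nat \<Rightarrow> real^'nx" and v :: "nat \<Rightarrow> real^'nv"
  let ?\<Phi> = "gov_Phi \<F> V"
  assume x0: "x0 \<in> fst ` ?\<Phi>"
    and loop: "x 0 = x0 \<and> v 0 = gov_gbar G \<F> V vs r x0
       \<and> (\<forall>k. x (Suc k) = closed_loop A B C D G Y N T P Q R (x k) (v k)
             \<and> v (Suc k) = gov_g G \<Gamma> \<F> V vs r (x (Suc k)) (v k))"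
  obtain M :: "real^'nv \<Rightarrow> (real^'nz) \<times> (real^'nv)" and p where M: "linear M" "inj M"
    and cost: "\<And>w. gov_cost G vs r w = (norm (M w - p))\<^sup>2"
    by (rule gov_cost_least_squares[of G vs r]) blast
  have cost_eq: "gov_cost G vs r = (\<lambda>w. (norm (M w - p))\<^sup>2)" using cost by auto
  have Y': "closed ((\<lambda>y. (1 - \<epsilon>) *\<^sub>R y) ` Y)" "convex ((\<lambda>y. (1 - \<epsilon>) *\<^sub>R y) ` Y)"
    by (rule closed_scaling[OF compact_imp_closed[OF Y(1)]],
        rule convex_scaling[OF polyhedron_imp_convex[OF Y(2)]])
  have V_eq: "V = (*v) (Gy C D G) -` ((\<lambda>y. (1 - \<epsilon>) *\<^sub>R y) ` Y)"
    by (auto simp: V_def V_eps_def)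
  have V: "closed V" "convex V"
    unfolding V_eq
    by (intro closed_vimage Y' matrix_vector_mult_linear_continuous_on,
        intro convex_linear_vimage Y' matrix_vector_mul_linear)
  interpret mpc A B C D G Y N T K P Q R
    by unfold_locales (use kernel_basis_equilibrium[OF G] N Y Q R P T_poly T_cost T_inv T_con in auto)
  have closed_section: "closed {w. (y, w) \<in> ?\<Phi>}" for y
  proof -
    have "closed (Pair y -` \<F>)" by (intro closed_vimage F_poly(1) continuous_intros)
    moreover have "{w. (y, w) \<in> ?\<Phi>} = Pair y -` \<F> \<inter> V" by (auto simp: gov_Phi_def)
    ultimately show ?thesis using V(1) by (simp add: closed_Int)
  qed
  have gbar: "is_arg_min (gov_cost G vs r) (\<lambda>w. w \<in> {w. (y, w) \<in> ?\<Phi>}) (gov_gbar G \<F> V vs r y)"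
    if "(y, w) \<in> ?\<Phi>" for y w
  proof -
    have "{w. (y, w) \<in> ?\<Phi>} \<noteq> {}" using that by auto
    then obtain a where "is_arg_min (gov_cost G vs r) (\<lambda>w. w \<in> {w. (y, w) \<in> ?\<Phi>}) a"
      unfolding cost_eq using least_squares_minimizer_exists[OF M closed_section] by blast
    then show ?thesis unfolding gov_gbar_def by (rule is_arg_min_arg_min_on)
  qed
  have init: "(x 0, v 0) \<in> ?\<Phi>"
  proof -
    obtain w where "(x0, w) \<in> ?\<Phi>" using x0 by auto
    then show ?thesis using gbar loop by (auto simp: is_arg_min_linorder)
  qed
  have step: "x (Suc k) = successor (x k) (v k)" for k using loop by blast
  have gov: "v (Suc k) = gov_g G \<Gamma> \<F> V vs r (x (Suc k)) (v k)" for k using loop by blast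
  have inv: "(x k, v k) \<in> \<Gamma> \<and> v k \<in> V" for k
  proof (induction k)
    case 0
    then show ?case using init F_sub by (auto simp: gov_Phi_def)
  next
    case (Suc k)
    have next_dom: "(x (Suc k), v k) \<in> \<Gamma>"
      using Suc recursive_feasibility unfolding step Gamma_def by blast
    show ?case
    proof (cases "(x (Suc k), v k) \<in> ?\<Phi>")
      case True
      then have "(x (Suc k), v (Suc k)) \<in> ?\<Phi>"
        using gbar[OF True] gov[of k] by (simp add: gov_g_def is_arg_min_linorder)
      then show ?thesis using F_sub by (auto simp: gov_Phi_def)
    next
      case False
      then have "v (Suc k) = v k"
        using gov[of k] next_dom Suc by (simp add: gov_g_def gov_Lambda_def)
      then show ?thesis using next_dom Suc by simp
    qed
  qed
  \<comment> \<open>without injectivity the cost is the squared distance to \<open>vs\<close>, which is an element of \<open>V\<close>\<close>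
  have vs_min: "is_arg_min (gov_cost G vs r) (\<lambda>w. w \<in> V) vs"
    using vs by (auto simp: gov_cost_def is_arg_min_linorder)
  show "\<exists>t. \<forall>k\<ge>t. v k = vs"
  proof (rule governor_reaches_optimum[where x = x and h = "xbar G", OF M cost V F_poly(2) vs_min])
    show "linear (xbar G)" unfolding xbar_def by (rule matrix_vector_mul_linear)
    show "(xbar G w, w) \<in> interior \<F>" if "w \<in> V" for w
      using that Sigma_F by (auto simp: steady_set_def xbar_def V_def)
    show "v 0 \<in> V" using inv by blast
    show "is_arg_min (gov_cost G vs r) (\<lambda>w. w \<in> {w. (x (Suc k), w) \<in> \<F> \<and> w \<in> V}) (v (Suc k))"
      if "(x (Suc k), v k) \<in> \<F>" "v k \<in> V" for k
    proof -
      have \<Phi>: "(x (Suc k), v k) \<in> ?\<Phi>" using that by (simp add: gov_Phi_def)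
      then show ?thesis using gbar[OF \<Phi>] gov[of k] by (simp add: gov_g_def) (simp add: gov_Phi_def)
    qed
    show "v (Suc k) = v k" if "(x (Suc k), v k) \<notin> \<F>" "v k \<in> V" for k
    proof -
      have "(x (Suc k), v k) \<in> \<Gamma>"
        using inv[of k] recursive_feasibility unfolding step Gamma_def by blast
      then show ?thesis using that gov[of k] by (simp add: gov_g_def gov_Phi_def gov_Lambda_def)
    qed
    show "\<exists>k\<ge>k0. norm (x k - xbar G (v k)) < \<eta>"
      if "(\<lambda>k. v (Suc k) - v k) \<longlonglongrightarrow> 0" "\<eta> > 0" for \<eta> k0
      using inv that by (intro tracking_error_frequently_small step) (auto simp: Gamma_def)
  qed
qed

end
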